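(* There is a Radon probability measure $\mu$ on $\mathbb{R}^{2N}$ such that $$\langle\mu,\Phi\rangle\ge\langle\mu,L\rangle=0$$ for every $\Phi\in C(\mathbb{R}^{2N})$ bounded from below and admitting a subsolution.
   Context: $H:\mathbb{R}^N\times\mathbb{R}^N\to\mathbb{R}$ satisfies: (A1) $H$ is continuous; (A2) $p\mapsto H(x,p)$ is convex for every $x$, and for every $R>0$, $\lim_{r\to+\infty}\inf\{H(x,p)\mid |x|<R,\ |p|\ge r\}=+\infty$; (A3) there is $\varepsilon>0$ with $\limsup_{|x|\to+\infty}\sup_{|p|<\varepsilon}H(x,p)<\max_{x\in\mathbb{R}^N}\min_{p\in\mathbb{R}^N}H(x,p)$; and, moreover, $\lim_{|p|\to+\infty}H(x,p)/|p|=+\infty$ for every $x$. The critical value $c=\inf\{a\in\mathbb{R}\mid H(x,Du)=a \text{ admits viscosity subsolutions in }\mathbb{R}^N\}$ is finite and is normalized to be $c=0$. The Lagrangian is $L(x,q)=\max_{p\in\mathbb{R}^N}\,(p\cdot q-H(x,p))$. For $\Phi\in C(\mathbb{R}^{2N})$, a locally Lipschitz function $u:\mathbb{R}^N\to\mathbb{R}$ is a subsolution for $\Phi$ if $Du(x)\cdot q\le\Phi(x,q)$ for a.e. $x\in\mathbb{R}^N$ and every $q\in\mathbb{R}^N$. $\langle\mu,\Phi\rangle=\int\Phi\,d\mu$ (possibly $+\infty$ for $\Phi$ bounded from below). *)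

theory Defs
  imports "HOL-Probability.Probability"
begin

text \<open>
  Hamiltonians, Lagrangians and the functions \<open>\<Phi>\<close> are functions of a pair, so that
  $\mathbb{R}^{2N}$ is rendered as \<open>(real ^ 'n) \<times> (real ^ 'n)\<close> with \<open>N = CARD('n)\<close>.
  Infima and suprema in the assumptions are taken in \<open>ereal\<close>.
\<close>

definition coercive_convex :: "((real ^ 'n) \<times> (real ^ 'n) \<Rightarrow> real) \<Rightarrow> bool" where
  "coercive_convex H \<longleftrightarrow>
     (\<forall>x. convex_on UNIV (\<lambda>p. H (x, p))) \<and>
     (\<forall>R>0. ((\<lambda>r::real. INF z\<in>{(x, p). norm x < R \<and> norm p \<ge> r}. ereal (H z))
               \<longlongrightarrow> \<infinity>) at_top)"

text \<open>
  In the next definition the outer supremum and the inner infimum on the right are a maximum and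
  a minimum: for a continuous coercive \<open>H\<close> the infimum over \<open>p\<close> is attained and continuous
  in \<open>x\<close>, and the inequality itself keeps the supremum over \<open>x\<close> from being approached at infinity.
\<close>

definition strict_at_infinity :: "((real ^ 'n) \<times> (real ^ 'n) \<Rightarrow> real) \<Rightarrow> bool" where
  "strict_at_infinity H \<longleftrightarrow>
     (\<exists>\<epsilon>>0. Limsup at_infinity (\<lambda>x. SUP p\<in>ball 0 \<epsilon>. ereal (H (x, p)))
             < (SUP x. INF p. ereal (H (x, p))))"

definition superlinear :: "((real ^ 'n) \<times> (real ^ 'n) \<Rightarrow> real) \<Rightarrow> bool" where
  "superlinear H \<longleftrightarrow> (\<forall>x. filterlim (\<lambda>p. H (x, p) / norm p) at_top at_infinity)"

text \<open>
  Viscosity subsolutions are taken continuous and real-valued; the test functions are the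
  \<open>C\<^sup>1\<close> functions \<open>\<phi>\<close> (with gradient \<open>g\<close>) such that \<open>u - \<phi>\<close> has a local maximum at \<open>x\<close>.
\<close>

definition viscosity_subsolution ::
  "((real ^ 'n) \<times> (real ^ 'n) \<Rightarrow> real) \<Rightarrow> real \<Rightarrow> (real ^ 'n \<Rightarrow> real) \<Rightarrow> bool" where
  "viscosity_subsolution H a u \<longleftrightarrow>
     continuous_on UNIV u \<and>
     (\<forall>\<phi> g x. (\<forall>y. GDERIV \<phi> y :> g y) \<and> continuous_on UNIV g \<and>
        (\<forall>\<^sub>F y in nhds x. u y - \<phi> y \<le> u x - \<phi> x) \<longrightarrow> H (x, g x) \<le> a)"

definition critical_value :: "((real ^ 'n) \<times> (real ^ 'n) \<Rightarrow> real) \<Rightarrow> ereal" where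
  "critical_value H = (INF a\<in>{a. \<exists>u. viscosity_subsolution H a u}. ereal a)"

text \<open>
  The supremum in the Lagrangian is a maximum (in particular it is finite) for continuous
  superlinear \<open>H\<close>.
\<close>

definition lagrangian ::
  "((real ^ 'n) \<times> (real ^ 'n) \<Rightarrow> real) \<Rightarrow> (real ^ 'n) \<times> (real ^ 'n) \<Rightarrow> real" where
  "lagrangian H = (\<lambda>(x, q). SUP p. p \<bullet> q - H (x, p))"

definition locally_Lipschitz :: "(real ^ 'n \<Rightarrow> real) \<Rightarrow> bool" where
  "locally_Lipschitz u \<longleftrightarrow> (\<forall>x. \<exists>r>0. \<exists>C. C-lipschitz_on (ball x r) u)"

text \<open>
  The existence of the gradient \<open>D\<close> at almost every point is automatic for locally Lipschitz
  functions, by Rademacher's theorem.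
\<close>

definition subsolution_for ::
  "((real ^ 'n) \<times> (real ^ 'n) \<Rightarrow> real) \<Rightarrow> (real ^ 'n \<Rightarrow> real) \<Rightarrow> bool" where
  "subsolution_for \<Phi> u \<longleftrightarrow>
     locally_Lipschitz u \<and>
     (AE x in lebesgue. \<exists>D. GDERIV u x :> D \<and> (\<forall>q. D \<bullet> q \<le> \<Phi> (x, q)))"

definition radon_probability :: "'a::topological_space measure \<Rightarrow> bool" where
  "radon_probability \<mu> \<longleftrightarrow>
     sets \<mu> = sets borel \<and> prob_space \<mu> \<and>
     (\<forall>B\<in>sets borel. emeasure \<mu> B = (SUP K\<in>{K. K \<subseteq> B \<and> compact K}. emeasure \<mu> K))"

text \<open>
  The integral with values in the extended reals, as positive part minus negative part. The
  negative part is finite whenever \<open>\<Phi>\<close> is bounded from below and \<open>\<mu>\<close> is a probability measure.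
\<close>

definition pairing :: "'a measure \<Rightarrow> ('a \<Rightarrow> real) \<Rightarrow> ereal" where
  "pairing \<mu> \<Phi> = enn2ereal (\<integral>\<^sup>+ z. ennreal (\<Phi> z) \<partial>\<mu>) - enn2ereal (\<integral>\<^sup>+ z. ennreal (- \<Phi> z) \<partial>\<mu>)"

end

theory Submission
  imports Defs
begin

text \<open>
  Write \<open>L\<close> for the Lagrangian. A closed polygon traversed with velocities \<open>q\<^sub>i\<close> during times \<open>t\<^sub>i\<close>
  carries an occupation measure, the time average of the point masses at the pairs
  (position, velocity). If \<open>u\<close> is a subsolution for \<open>\<Phi>\<close>, the increment of \<open>u\<close> along a step is at most
  the integral of \<open>\<Phi>\<close> along it, and around a closed polygon the increments cancel: the occupation
  measure gives \<open>\<Phi>\<close> a nonnegative integral. The measure \<open>\<mu>\<close> is a limit of occupation measures of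
  closed polygons whose average \<open>L\<close>-action is asymptotically \<open>\<le> 0\<close>.

  Such polygons exist because the critical value is \<open>0\<close>. Let \<open>a < 0\<close>. If every closed polygon had
  nonnegative action for \<open>L + a\<close>, the least action \<open>w x\<close> of a polygon from \<open>0\<close> to \<open>x\<close> would be
  finite and would satisfy \<open>p \<bullet> q \<le> L (x, q) + a\<close> for every \<open>p\<close> that is the gradient at \<open>x\<close> of a
  function touching \<open>w\<close> from above, that is, \<open>H (x, p) \<le> a\<close> by convex duality: \<open>w\<close> would be a viscosity
  subsolution below the critical level.

  A weak limit preserves the inequalities for every continuous \<open>\<Phi>\<close>, whatever its growth, if
  all polygons lie in one compact subset of the phase space. Two observations confine them.
  The velocities may be bounded by a constant \<open>M\<close> when \<open>x\<close> ranges over a ball, because the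
  subgradients of \<open>H (x, _)\<close> on bounded sets are bounded (\<open>bounded_velocities_suffice\<close>). The positions
  may be confined to a large ball, because outside some smaller ball \<open>L (x, q) \<ge> \<epsilon> * norm q + \<delta>\<close>: there
  \<open>w\<close> grows with slope \<open>\<epsilon>\<close>, so the minimum of \<open>w\<close> and a cone of slope \<open>\<epsilon> / 2\<close> coincides with
  \<open>w\<close> near the origin and with the cone near the boundary of the large ball, and extends to a subsolution
  on the whole space (\<open>negative_closed_chain\<close>).

  Polygons are replaced by chains of steps of duration at most \<open>\<tau>\<close> whose action is evaluated
  at the initial point of each step; the error vanishes as \<open>\<tau>\<close> tends to \<open>0\<close> by uniform continuity. The
  increments of a subsolution are estimated in \<open>subsolution_for_dominated\<close> for locally Lipschitz
  functions, and in \<open>viscosity_subsolution_dominated\<close> for viscosity subsolutions; the latter, applied at levels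
  arbitrarily close to the critical one, gives \<open>\<langle>\<mu>, L\<rangle> \<ge> 0\<close>. Compactness of the occupation measures is
  deduced from Helly's theorem on the real line by lifting them along a space-filling curve
  (\<open>discrete_measures_subconverge\<close>).
\<close>

section \<open>Convex duality for superlinear Hamiltonians\<close>

text \<open>
  The strict hypograph over the single point \<open>x\<close> and the epigraph are disjoint convex sets; a
  separating hyperplane cannot be vertical because the function is finite everywhere.
\<close>
lemma convex_has_subgradient:
  fixes f :: "'a::euclidean_space \<Rightarrow> real"
  assumes "convex_on UNIV f"
  obtains q where "\<And>y. f y \<ge> f x + (y - x) \<bullet> q"
proof -
  have "convex (epigraph UNIV f)" using assms by (rule convex_epigraphI)
  moreover have "convex ({x} \<times> {..<f x})" by (intro convex_Times) auto
  moreover have "({x} \<times> {..<f x}) \<inter> epigraph UNIV f = {}" by (auto simp: epigraph_def)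
  moreover have "(x, f x) \<in> epigraph UNIV f" "(x, f x - 1) \<in> {x} \<times> {..<f x}" by (auto simp: epigraph_def)
  ultimately obtain a b where ab: "a \<noteq> 0" "\<And>z. z \<in> {x} \<times> {..<f x} \<Longrightarrow> a \<bullet> z \<le> b"
      "\<And>z. z \<in> epigraph UNIV f \<Longrightarrow> a \<bullet> z \<ge> b"
    using separating_hyperplane_sets[of "{x} \<times> {..<f x}" "epigraph UNIV f"] by blast
  obtain \<alpha> \<beta> where a: "a = (\<alpha>, \<beta>)" by (cases a)
  have lo: "\<alpha> \<bullet> x + \<beta> * r \<le> b" if "r < f x" for r
    using ab(2)[of "(x, r)"] that by (simp add: a)
  have up: "b \<le> \<alpha> \<bullet> y + \<beta> * f y" for y
    using ab(3)[of "(y, f y)"] by (simp add: a epigraph_def)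
  \<comment> \<open>The vertical ray below \<open>f x\<close> is unbounded, which excludes a downward normal.\<close>
  have "\<beta> \<ge> 0"
  proof (rule ccontr)
    assume "\<not> \<beta> \<ge> 0"
    then have neg: "\<beta> < 0" by simp
    define r where "r = min (f x - 1) ((b - \<alpha> \<bullet> x + 1) / \<beta>)"
    have "\<beta> * r \<ge> \<beta> * ((b - \<alpha> \<bullet> x + 1) / \<beta>)"
      using neg by (intro mult_left_mono_neg) (auto simp: r_def)
    then have "\<beta> * r \<ge> b - \<alpha> \<bullet> x + 1" using neg by simp
    moreover have "r < f x" by (auto simp: r_def)
    ultimately show False using lo[of r] by linarith
  qed
  moreover have "\<beta> \<noteq> 0"
  proof
    assume "\<beta> = 0"
    then have "\<alpha> \<bullet> x \<le> \<alpha> \<bullet> (x - \<alpha>)"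
      using lo[of "f x - 1"] up[of "x - \<alpha>"] by simp
    then have "\<alpha> \<bullet> \<alpha> \<le> 0" by (simp add: inner_diff_right)
    then have "\<alpha> = 0" using inner_gt_zero_iff[of \<alpha>] by linarith
    with \<open>\<beta> = 0\<close> show False using ab(1) a by (simp add: zero_prod_def)
  qed
  ultimately have pos: "\<beta> > 0" by simp
  have main: "\<alpha> \<bullet> x + \<beta> * f x \<le> \<alpha> \<bullet> y + \<beta> * f y" for y
  proof (rule field_le_epsilon)
    fix e :: real assume "e > 0"
    then show "\<alpha> \<bullet> x + \<beta> * f x \<le> \<alpha> \<bullet> y + \<beta> * f y + e"
      using lo[of "f x - e / \<beta>"] up[of y] pos by (simp add: algebra_simps)
  qed
  show ?thesis
  proof
    fix y
    show "f y \<ge> f x + (y - x) \<bullet> (- (\<alpha> /\<^sub>R \<beta>))"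
      using main[of y] pos by (simp add: inner_diff_left inner_commute[of \<alpha>] field_simps)
  qed
qed

locale superlinear_hamiltonian =
  fixes H :: "(real ^ 'n) \<times> (real ^ 'n) \<Rightarrow> real"
  assumes cont: "continuous_on UNIV H"
    and conv: "convex_on UNIV (\<lambda>p. H (x, p))"
    and superlin: "superlinear H"
begin

abbreviation "L \<equiv> lagrangian H"

lemma continuous_H [continuous_intros]:
  "continuous_on S f \<Longrightarrow> continuous_on S g \<Longrightarrow> continuous_on S (\<lambda>x. H (f x, g x))"
  using continuous_on_compose2[OF cont, of S "\<lambda>x. (f x, g x)"] by (auto intro: continuous_on_Pair)

lemma tendsto_H:
  "(f \<longlongrightarrow> x) F \<Longrightarrow> (g \<longlongrightarrow> p) F \<Longrightarrow> ((\<lambda>n. H (f n, g n)) \<longlongrightarrow> H (x, p)) F"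
  using continuous_on_tendsto_compose[OF cont tendsto_Pair] by simp

lemma radial_convexity:
  assumes "0 \<le> \<theta>" "\<theta> \<le> 1"
  shows "H (x, \<theta> *\<^sub>R p) \<le> (1 - \<theta>) * H (x, 0) + \<theta> * H (x, p)"
  using convex_onD[OF conv[of x], of \<theta> 0 p] assms by simp

text \<open>
  Superlinearity is assumed for each \<open>x\<close> separately. It is uniform for \<open>x\<close> in a ball because a
  sequence of counterexamples \<open>(x\<^sub>n, p\<^sub>n)\<close> with \<open>p\<^sub>n\<close> tending to infinity yields, by convexity along the rays and by compactness,
  a point \<open>x\<^sub>0\<close> and a direction in which \<open>H (x\<^sub>0, _)\<close> grows at most linearly.
\<close>
lemma superlinear_locally_uniformly:
  "\<exists>P>0. \<forall>x p. norm x \<le> R \<and> norm p \<ge> P \<longrightarrow> H (x, p) \<ge> H (x, 0) + Q * norm p"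
proof (rule ccontr)
  assume neg: "\<not> ?thesis"
  have "\<exists>x p. norm x \<le> R \<and> norm p \<ge> Suc n \<and> H (x, p) < H (x, 0) + Q * norm p" for n :: nat
    using neg[simplified, rule_format, of "real (Suc n)"] by (auto simp: not_le simp del: of_nat_Suc)
  then obtain X p where Xp: "\<And>n. norm (X n) \<le> R" "\<And>n. norm (p n) \<ge> Suc n"
      "\<And>n. H (X n, p n) < H (X n, 0) + Q * norm (p n)" by metis
  have p0: "norm (p n) > 0" for n using Xp(2)[of n] by (metis less_le_trans of_nat_0_less_iff zero_less_Suc)
  define e where "e n = p n /\<^sub>R norm (p n)" for n
  have comp: "compact (cball 0 R \<times> sphere 0 1 :: ((real^'n) \<times> (real^'n)) set)" by (intro compact_Times) auto
  have mem: "\<forall>n. (X n, e n) \<in> cball 0 R \<times> sphere 0 1"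
    using Xp(1) p0 by (auto simp: e_def)
  obtain z r where z: "z \<in> cball 0 R \<times> sphere 0 1" "strict_mono r" 
      and lim: "((\<lambda>n. (X n, e n)) \<circ> r) \<longlonglongrightarrow> z"
    using seq_compactE[OF compact_imp_seq_compact[OF comp] mem] .
  obtain x0 e0 where z_eq: "z = (x0, e0)" by (cases z)
  have Xlim: "(\<lambda>n. X (r n)) \<longlonglongrightarrow> x0" and elim: "(\<lambda>n. e (r n)) \<longlonglongrightarrow> e0"
    using tendsto_fst[OF lim] tendsto_snd[OF lim] by (auto simp: z_eq comp_def)
  \<comment> \<open>Convexity carries the bound at \<open>p\<^sub>n\<close> down to radius \<open>P\<close>, where the limit can be taken.\<close>
  have bound: "H (x0, P *\<^sub>R e0) \<le> H (x0, 0) + P * Q" if P: "P > 0" for P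
  proof (rule tendsto_le[OF sequentially_bot])
    show "(\<lambda>n. H (X (r n), P *\<^sub>R e (r n))) \<longlonglongrightarrow> H (x0, P *\<^sub>R e0)"
      by (intro tendsto_H tendsto_intros Xlim elim)
    show "(\<lambda>n. H (X (r n), 0) + P * Q) \<longlonglongrightarrow> H (x0, 0) + P * Q"
      by (intro tendsto_H tendsto_intros Xlim)
    show "\<forall>\<^sub>F n in sequentially. H (X (r n), P *\<^sub>R e (r n)) \<le> H (X (r n), 0) + P * Q"
    proof (rule eventually_sequentiallyI[of "nat \<lceil>P\<rceil>"])
      fix n assume "nat \<lceil>P\<rceil> \<le> n"
      then have "P \<le> real (Suc (r n))"
        using seq_suble[OF z(2), of n] by linarith
      then have Pp: "P \<le> norm (p (r n))" using Xp(2)[of "r n"] by linarith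
      define \<theta> where "\<theta> = P / norm (p (r n))"
      have \<theta>: "0 \<le> \<theta>" "\<theta> \<le> 1" using P Pp p0[of "r n"] by (auto simp: \<theta>_def field_simps)
      have "P *\<^sub>R e (r n) = \<theta> *\<^sub>R p (r n)" by (simp add: e_def \<theta>_def divide_inverse)
      then have "H (X (r n), P *\<^sub>R e (r n)) \<le> (1 - \<theta>) * H (X (r n), 0) + \<theta> * H (X (r n), p (r n))"
        using radial_convexity[OF \<theta>] by simp
      also have "\<dots> \<le> (1 - \<theta>) * H (X (r n), 0) + \<theta> * (H (X (r n), 0) + Q * norm (p (r n)))"
        using Xp(3)[of "r n"] \<theta> by (intro add_left_mono mult_left_mono) auto
      also have "\<dots> = H (X (r n), 0) + P * Q"
        using p0[of "r n"] by (simp add: \<theta>_def field_simps)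
      finally show "H (X (r n), P *\<^sub>R e (r n)) \<le> H (X (r n), 0) + P * Q" .
    qed
  qed
  define c where "c = \<bar>H (x0, 0)\<bar> + 1"
  define A where "A = Q + c"
  have "filterlim (\<lambda>p. H (x0, p) / norm p) at_top at_infinity"
    using superlin by (simp add: superlinear_def)
  then have "\<forall>\<^sub>F p in at_infinity. A \<le> H (x0, p) / norm p"
    by (simp add: filterlim_at_top)
  then obtain b where b: "\<And>p. norm p \<ge> b \<Longrightarrow> A \<le> H (x0, p) / norm p"
    by (auto simp: eventually_at_infinity)
  define P where "P = max 1 b"
  have P: "P \<ge> 1" "P \<ge> b" by (auto simp: P_def)
  have n: "norm (P *\<^sub>R e0) = P" using z(1) P by (simp add: z_eq)
  then have "A \<le> H (x0, P *\<^sub>R e0) / P" using b[of "P *\<^sub>R e0"] P(2) by simp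
  then have "P * A \<le> H (x0, P *\<^sub>R e0)" using P(1) by (simp add: field_simps)
  also have "\<dots> \<le> H (x0, 0) + P * Q" using bound P(1) by auto
  finally have "P * c \<le> H (x0, 0)" by (simp add: A_def algebra_simps)
  moreover have "1 * c \<le> P * c" using P(1) by (intro mult_right_mono) (auto simp: c_def)
  moreover have "H (x0, 0) < c" by (simp add: c_def)
  ultimately show False by simp
qed

text \<open>
  Outside a ball of radius \<open>P\<close> the expression defining the Lagrangian is no better than at \<open>p = 0\<close>, so the
  supremum may be restricted to a compact set that is the same for all nearby \<open>(x, q)\<close>.
\<close>
lemma maximisers_locally_bounded:
  obtains P where "P > 0" "\<And>x q p. norm x \<le> R \<Longrightarrow> norm q \<le> Q \<Longrightarrow> norm p \<ge> P \<Longrightarrow> p \<bullet> q - H (x, p) \<le> - H (x, 0)"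
proof -
  obtain P where P: "P > 0" "\<And>x p. norm x \<le> R \<Longrightarrow> norm p \<ge> P \<Longrightarrow> H (x, p) \<ge> H (x, 0) + Q * norm p"
    using superlinear_locally_uniformly[of R Q] by auto
  show ?thesis
  proof
    show "P > 0" by fact
    fix x q p :: "real^'n" assume a: "norm x \<le> R" "norm q \<le> Q" "norm p \<ge> P"
    have "p \<bullet> q \<le> norm q * norm p" using norm_cauchy_schwarz[of p q] by (simp add: mult.commute)
    also have "\<dots> \<le> Q * norm p" using a(2) by (intro mult_right_mono) auto
    finally show "p \<bullet> q - H (x, p) \<le> - H (x, 0)" using P(2)[OF a(1,3)] by simp
  qed
qed

lemma lagrangian_bdd_above: "bdd_above (range (\<lambda>p. p \<bullet> q - H (x, p)))"
proof -
  obtain P where P: "P > 0" "\<And>p. norm p \<ge> P \<Longrightarrow> p \<bullet> q - H (x, p) \<le> - H (x, 0)"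
    using maximisers_locally_bounded[of "norm x" "norm q"] by (metis order_refl)
  have "compact ((\<lambda>p. p \<bullet> q - H (x, p)) ` cball 0 P)"
    by (intro compact_continuous_image continuous_intros) auto
  then obtain B where B: "\<And>p. norm p \<le> P \<Longrightarrow> p \<bullet> q - H (x, p) \<le> B"
    using bounded_imp_bdd_above[OF compact_imp_bounded] unfolding bdd_above_def by fastforce
  show ?thesis
    by (rule bdd_aboveI2[of _ _ "max B (- H (x, 0))"]) (use B P(2) in \<open>meson le_max_iff_disj linear\<close>)
qed

lemma fenchel: "p \<bullet> q - H (x, p) \<le> L (x, q)"
  unfolding lagrangian_def prod.case by (rule cSUP_upper[OF _ lagrangian_bdd_above]) simp

lemma lagrangian_leI: "(\<And>p. p \<bullet> q - H (x, p) \<le> c) \<Longrightarrow> L (x, q) \<le> c"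
  unfolding lagrangian_def by (simp add: cSUP_least)

lemma lagrangian_at_subgradient:
  assumes "\<And>p'. H (x, p') \<ge> H (x, p) + (p' - p) \<bullet> q"
  shows "L (x, q) = p \<bullet> q - H (x, p)"
proof (rule antisym)
  show "L (x, q) \<le> p \<bullet> q - H (x, p)"
  proof (rule lagrangian_leI)
    fix p'
    show "p' \<bullet> q - H (x, p') \<le> p \<bullet> q - H (x, p)"
      using assms[of p'] by (simp add: inner_diff_left)
  qed
qed (rule fenchel)

lemma continuous_lagrangian: "continuous_on UNIV L"
  unfolding continuous_on_iff
proof (intro ballI allI impI)
  fix z0 :: "(real^'n) \<times> (real^'n)" and \<epsilon> :: real assume "\<epsilon> > 0"
  obtain P where P: "P > 0" "\<And>x q p. norm x \<le> norm z0 + 1 \<Longrightarrow> norm q \<le> norm z0 + 1 \<Longrightarrow> norm p \<ge> P \<Longrightarrow> p \<bullet> q - H (x, p) \<le> - H (x, 0)"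
    using maximisers_locally_bounded[of "norm z0 + 1" "norm z0 + 1"] by metis
  define F where "F w = (snd w \<bullet> snd (fst w) - H (fst (fst w), snd w))" for w :: "((real^'n) \<times> (real^'n)) \<times> (real^'n)"
  define K where "K = cball z0 1 \<times> cball (0::real^'n) P"
  have "compact K" unfolding K_def by (intro compact_Times) auto
  moreover have "continuous_on K F" unfolding F_def by (intro continuous_intros)
  ultimately have "uniformly_continuous_on K F" by (rule compact_uniformly_continuous[rotated])
  then obtain d where d: "d > 0" "\<And>w w'. w \<in> K \<Longrightarrow> w' \<in> K \<Longrightarrow> dist w' w < d \<Longrightarrow> dist (F w') (F w) < \<epsilon> / 2"
    unfolding uniformly_continuous_on_def using \<open>\<epsilon> > 0\<close> by (metis half_gt_zero)
  have le: "L z \<le> L z' + \<epsilon> / 2" if z: "z \<in> cball z0 1" "z' \<in> cball z0 1" "dist z z' < d" for z z'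
  proof -
    obtain x q where zeq: "z = (x, q)" by (cases z)
    obtain x' q' where z'eq: "z' = (x', q')" by (cases z')
    have near: "p \<bullet> q - H (x, p) \<le> L z' + \<epsilon> / 2" if "norm p \<le> P" for p
    proof -
      have "dist (F (z, p)) (F (z', p)) < \<epsilon> / 2"
        using that z by (intro d(2)) (auto simp: K_def dist_Pair_Pair)
      then have "F (z, p) \<le> F (z', p) + \<epsilon> / 2" unfolding dist_real_def by linarith
      moreover have "F (z', p) \<le> L z'" using fenchel[of p q' x'] by (simp add: F_def z'eq)
      ultimately show ?thesis by (simp add: F_def zeq)
    qed
    have "norm z \<le> norm z0 + 1"
      using z(1) norm_triangle_ineq2[of z z0] by (simp add: dist_norm norm_minus_commute)
    then have xq: "norm x \<le> norm z0 + 1" "norm q \<le> norm z0 + 1"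
      using norm_fst_le[of x q] norm_snd_le[of q x] by (auto simp: zeq)
    show ?thesis
      unfolding zeq
    proof (rule lagrangian_leI)
      fix p
      show "p \<bullet> q - H (x, p) \<le> L z' + \<epsilon> / 2"
      proof (cases "norm p \<le> P")
        case False
        then have "p \<bullet> q - H (x, p) \<le> - H (x, 0)" using P(2)[OF xq] by simp
        with near[of 0] P(1) show ?thesis by simp
      qed (rule near)
    qed
  qed
  show "\<exists>d>0. \<forall>z\<in>UNIV. dist z z0 < d \<longrightarrow> dist (L z) (L z0) < \<epsilon>"
  proof (intro exI[of _ "min 1 d"] conjI ballI impI)
    fix z assume "dist z z0 < min 1 d"
    then show "dist (L z) (L z0) < \<epsilon>"
      using le[of z z0] le[of z0 z] \<open>\<epsilon> > 0\<close> by (auto simp: dist_real_def dist_commute abs_less_iff)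
  qed (use d in auto)
qed

text \<open>
  The dual inequality has to be tested only with subgradients \<open>q\<close>. If \<open>norm p \<le> P\<close>, a subgradient
  at \<open>p\<close> is bounded and turns the inequality into \<open>H (x, p) \<le> a\<close>. If \<open>norm p > P\<close>, a subgradient at the
  radial projection \<open>p'\<close> of \<open>p\<close> to the sphere of radius \<open>P\<close> would give \<open>H (x, p') \<le> a \<le> 0\<close>, whereas \<open>P\<close> is
  chosen such that \<open>H\<close> is positive, and larger than \<open>H (x, 0)\<close>, on that sphere.
\<close>
lemma bounded_velocities_suffice:
  obtains M where "M \<ge> 1"
    "\<And>x p a. norm x \<le> R \<Longrightarrow> a \<le> 0 \<Longrightarrow> (\<And>q. norm q \<le> M \<Longrightarrow> p \<bullet> q \<le> L (x, q) + a) \<Longrightarrow> H (x, p) \<le> a"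
proof -
  have bnd: "\<exists>B. \<forall>x p. norm x \<le> R \<longrightarrow> norm p \<le> P \<longrightarrow> \<bar>H (x, p)\<bar> \<le> B" for P
  proof -
    have "compact (H ` (cball 0 R \<times> cball 0 P))"
      by (intro compact_continuous_image compact_Times continuous_on_subset[OF cont]) auto
    then obtain B where "\<forall>z \<in> cball 0 R \<times> cball 0 P. \<bar>H z\<bar> \<le> B"
      using compact_imp_bounded[of "H ` (cball 0 R \<times> cball 0 P)"] unfolding bounded_real by blast
    then show ?thesis by (intro exI[of _ B]) auto
  qed
  obtain B0 where B0: "\<And>x. norm x \<le> R \<Longrightarrow> \<bar>H (x, 0)\<bar> \<le> B0" using bnd[of 0] by auto
  obtain P0 where P0: "P0 > 0" "\<And>x p. norm x \<le> R \<Longrightarrow> norm p \<ge> P0 \<Longrightarrow> H (x, p) \<ge> H (x, 0) + 1 * norm p"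
    using superlinear_locally_uniformly[of R 1] by blast
  define P where "P = max P0 (\<bar>B0\<bar> + 1)"
  have P: "P > 0" using P0(1) by (auto simp: P_def)
  have big: "H (x, p) > 0" "H (x, p) > H (x, 0)" if "norm x \<le> R" "norm p = P" for x p
  proof -
    have "H (x, p) \<ge> H (x, 0) + 1 * P" using P0(2)[OF that(1), of p] that by (simp add: P_def)
    moreover have "P \<ge> \<bar>B0\<bar> + 1" by (simp add: P_def)
    ultimately show "H (x, p) > 0" "H (x, p) > H (x, 0)" using B0[OF that(1)] by linarith+
  qed
  obtain B where B: "\<And>x p. norm x \<le> R \<Longrightarrow> norm p \<le> P + 1 \<Longrightarrow> \<bar>H (x, p)\<bar> \<le> B" using bnd[of "P + 1"] by auto
  \<comment> \<open>A subgradient is bounded by the oscillation of \<open>H (x, _)\<close> over a unit step in its direction.\<close>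
  have sub: "norm q \<le> max 1 (2 * B)" 
    if x: "norm x \<le> R" and p: "norm p \<le> P" and q: "\<And>p'. H (x, p') \<ge> H (x, p) + (p' - p) \<bullet> q" for x p q
  proof (cases "q = 0")
    case False
    have "norm (p + q /\<^sub>R norm q) \<le> P + 1"
      using norm_triangle_ineq[of p "q /\<^sub>R norm q"] p False by simp
    moreover have "(p + q /\<^sub>R norm q - p) \<bullet> q = norm q"
      using False by (simp add: dot_square_norm power2_eq_square)
    ultimately show ?thesis
      using q[of "p + q /\<^sub>R norm q"] B[OF x, of p] B[OF x, of "p + q /\<^sub>R norm q"] p by simp
  qed auto
  show ?thesis
  proof
    show "max 1 (2 * B) \<ge> 1" by simp
    fix x p a assume x: "norm x \<le> R" and a: "a \<le> 0" 
      and le: "\<And>q. norm q \<le> max 1 (2 * B) \<Longrightarrow> p \<bullet> q \<le> L (x, q) + a"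
    show "H (x, p) \<le> a"
    proof (cases "norm p \<le> P")
      case True
      obtain q where q: "\<And>p'. H (x, p') \<ge> H (x, p) + (p' - p) \<bullet> q"
        using convex_has_subgradient[OF conv[of x], of p] by auto
      show ?thesis
        using le[OF sub[OF x True q]] lagrangian_at_subgradient[OF q] by simp
    next
      case False
      define p' where "p' = (P / norm p) *\<^sub>R p"
      have pn: "p \<noteq> 0" using P False by (metis less_imp_le norm_zero)
      then have np: "norm p' = P" using P by (simp add: p'_def)
      obtain q where q: "\<And>p''. H (x, p'') \<ge> H (x, p') + (p'' - p') \<bullet> q"
        using convex_has_subgradient[OF conv[of x], of p'] by auto
      have "p \<bullet> q \<le> p' \<bullet> q - H (x, p') + a"
        using le[OF sub[OF x _ q]] np lagrangian_at_subgradient[OF q] by simp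
      moreover have "p' \<bullet> q > 0"
        using q[of 0] big(2)[OF x np] by simp
      then have "p \<bullet> q \<ge> p' \<bullet> q"
      proof -
        have "p \<bullet> q = (norm p / P) * (p' \<bullet> q)" using P pn by (simp add: p'_def)
        moreover have "1 * (p' \<bullet> q) \<le> (norm p / P) * (p' \<bullet> q)"
          using P False \<open>p' \<bullet> q > 0\<close> by (intro mult_right_mono) (simp_all add: le_divide_eq)
        ultimately show ?thesis by simp
      qed
      ultimately show ?thesis using big(1)[OF x np] a by simp
    qed
  qed
qed

end

section \<open>Chains and closed chains of negative action\<close>

text \<open>
  A step \<open>(y, q, t)\<close> starts at \<open>y\<close> and moves with velocity \<open>q\<close> for time \<open>t\<close>. The bounds \<open>R\<close> on the
  positions and \<open>M\<close> on the velocities keep all chains in one compact set. Steps are added at the end,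
  so that lower bounds for the action propagate along the induction rule.
\<close>
inductive chain :: "real \<Rightarrow> real \<Rightarrow> real \<Rightarrow> 'a::real_normed_vector \<Rightarrow> ('a \<times> 'a \<times> real) list \<Rightarrow> 'a \<Rightarrow> bool"
  for \<tau> R M :: real where
  empty: "norm x \<le> R \<Longrightarrow> chain \<tau> R M x [] x"
| step: "chain \<tau> R M x l y \<Longrightarrow> norm q \<le> M \<Longrightarrow> 0 < t \<Longrightarrow> t \<le> \<tau> \<Longrightarrow> norm (y + t *\<^sub>R q) \<le> R \<Longrightarrow>
    chain \<tau> R M x (l @ [(y, q, t)]) (y + t *\<^sub>R q)"

text \<open>
  The Riemann sum, with nodes at the initial points of the steps, of the action of \<open>F\<close> along the polygon.
\<close>
definition chain_sum :: "('a \<times> 'a \<Rightarrow> real) \<Rightarrow> ('a \<times> 'a \<times> real) list \<Rightarrow> real" where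
  "chain_sum F l = (\<Sum>(y, q, t)\<leftarrow>l. t * F (y, q))"

lemma chain_sum_simps [simp]:
  "chain_sum F [] = 0"
  "chain_sum F (l @ l') = chain_sum F l + chain_sum F l'"
  "chain_sum F [(y, q, t)] = t * F (y, q)"
  by (simp_all add: chain_sum_def)

lemma chain_append:
  assumes "chain \<tau> R M x l y" "chain \<tau> R M y l' z"
  shows "chain \<tau> R M x (l @ l') z"
  using assms(2,1)
proof (induction)
  case (step y l'' z q t)
  then show ?case using chain.step[of \<tau> R M x "l @ l''" z q t] by simp
qed simp

lemma chain_end: "chain \<tau> R M x l y \<Longrightarrow> norm y \<le> R"
  by (induction rule: chain.induct)

lemma chain_steps:
  "chain \<tau> R M x l y \<Longrightarrow> (z, q, t) \<in> set l \<Longrightarrow> norm z \<le> R \<and> norm q \<le> M \<and> 0 < t \<and> t \<le> \<tau>"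
proof (induction rule: chain.induct)
  case (step x l y q t)
  then show ?case using chain_end[OF step.hyps(1)] by auto
qed simp

lemma chain_telescope:
  assumes "chain \<tau> R M x l y" "\<And>z q t. norm z \<le> R \<Longrightarrow> norm q \<le> M \<Longrightarrow> 0 < t \<Longrightarrow> t \<le> \<tau> \<Longrightarrow> u (z + t *\<^sub>R q) - u z \<le> t * F (z, q)"
  shows "u y - u x \<le> chain_sum F l"
  using assms(1)
proof (induction)
  case (step x l y q t)
  then show ?case using assms(2)[of y q t] chain_end[OF step(1)] by auto
qed simp

text \<open>
  The segment traversed at unit speed, cut into equal steps; it serves to reach every point and to close
  chains at a cost proportional to the distance.
\<close>
lemma straight_chain:
  fixes x y :: "'a::real_inner"
  assumes "norm x \<le> r" "norm y \<le> r" "r \<le> R" "1 \<le> M" "0 < \<tau>"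
    and C: "\<And>z q. norm z \<le> r \<Longrightarrow> norm q = 1 \<Longrightarrow> F (z, q) \<le> C"
  obtains l where "chain \<tau> R M x l y" "chain_sum F l \<le> C * norm (y - x)"
proof (cases "x = y")
  case True
  have "chain \<tau> R M x [] y" unfolding True using assms by (intro chain.empty) simp
  then show ?thesis using that[of "[]"] True by simp
next
  case False
  define D where "D = norm (y - x)"
  define q where "q = (y - x) /\<^sub>R D"
  have D: "D > 0" using False by (simp add: D_def)
  have q: "norm q = 1" using D by (simp add: q_def D_def)
  obtain n :: nat where n: "D / \<tau> < real n" using reals_Archimedean2 by blast
  have "0 < D / \<tau>" using D assms(5) by simp
  then have n0: "n > 0" using n by (metis gr_zeroI less_asym of_nat_0)
  have yD: "y = x + D *\<^sub>R q" using D by (simp add: q_def)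
  define h where "h = D / real n"
  have h: "0 < h" "h \<le> \<tau>" using D n n0 assms(5) by (auto simp: h_def field_simps)
  have "\<exists>l. chain \<tau> R M x l (x + (real k * h) *\<^sub>R q) \<and> chain_sum F l \<le> C * (real k * h)" if "k \<le> n" for k
    using that
  proof (induction k)
    case 0
    then show ?case using assms by (auto intro!: exI[of _ "[]"] chain.empty)
  next
    case (Suc k)
    then obtain l where l: "chain \<tau> R M x l (x + (real k * h) *\<^sub>R q)" "chain_sum F l \<le> C * (real k * h)" by auto
    have inr: "norm (x + (real j * h) *\<^sub>R q) \<le> r" if "j \<le> n" for j
    proof -
      define s where "s = real j / real n"
      have s: "0 \<le> s" "s \<le> 1" using that n0 by (auto simp: s_def)
      have "(real j * h) *\<^sub>R q = s *\<^sub>R (y - x)"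
        using D by (simp add: h_def q_def s_def)
      then have "x + (real j * h) *\<^sub>R q = (1 - s) *\<^sub>R x + s *\<^sub>R y"
        by (simp add: algebra_simps)
      then have "norm (x + (real j * h) *\<^sub>R q) \<le> (1 - s) * norm x + s * norm y"
        using norm_triangle_ineq[of "(1 - s) *\<^sub>R x" "s *\<^sub>R y"] s by simp
      also have "\<dots> \<le> (1 - s) * r + s * r"
        using s assms by (intro add_mono mult_left_mono) auto
      finally show ?thesis by (simp add: algebra_simps)
    qed
    have eq: "x + (real (Suc k) * h) *\<^sub>R q = (x + (real k * h) *\<^sub>R q) + h *\<^sub>R q"
      by (simp add: algebra_simps)
    have "chain \<tau> R M x (l @ [(x + (real k * h) *\<^sub>R q, q, h)]) (x + (real (Suc k) * h) *\<^sub>R q)"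
      unfolding eq using q assms h order_trans[OF inr[OF Suc.prems, unfolded eq] assms(3)]
      by (intro chain.step l) auto
    moreover have "h * F (x + (real k * h) *\<^sub>R q, q) \<le> h * C"
      using h q inr[of k] Suc.prems by (intro mult_left_mono C) auto
    then have "chain_sum F (l @ [(x + (real k * h) *\<^sub>R q, q, h)]) \<le> C * (real (Suc k) * h)"
      using l(2) by (simp add: algebra_simps)
    ultimately show ?case by blast
  qed
  from this[of n] obtain l where "chain \<tau> R M x l (x + (real n * h) *\<^sub>R q)" "chain_sum F l \<le> C * (real n * h)" by blast
  moreover have "real n * h = D" using n0 by (simp add: h_def)
  ultimately show ?thesis using that[of l] unfolding yD[symmetric] by (simp only: yD[symmetric] D_def[symmetric])
qed

lemma gderiv_directional:
  fixes \<phi> :: "'a::real_inner \<Rightarrow> real"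
  assumes "GDERIV \<phi> x :> g"
  shows "((\<lambda>t. (\<phi> (x + t *\<^sub>R q) - \<phi> x) / t) \<longlongrightarrow> g \<bullet> q) (at 0)"
proof -
  have d: "((\<lambda>t. x + t *\<^sub>R q) has_derivative (\<lambda>t. t *\<^sub>R q)) (at 0)"
    by (auto intro!: derivative_eq_intros)
  have "((\<lambda>t. \<phi> (x + t *\<^sub>R q)) has_derivative (\<lambda>t. (t *\<^sub>R q) \<bullet> g)) (at 0)"
    using has_derivative_compose[OF d, of \<phi> "\<lambda>h. h \<bullet> g"] assms by (simp add: gderiv_def)
  then have "((\<lambda>t. \<phi> (x + t *\<^sub>R q)) has_field_derivative (q \<bullet> g)) (at 0)"
    by (rule has_derivative_imp_has_field_derivative) simp
  then show ?thesis
    by (simp add: has_field_derivative_iff inner_commute)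
qed

lemma gderiv_bound_along:
  fixes \<phi> :: "'a::real_inner \<Rightarrow> real"
  assumes "GDERIV \<phi> x :> g"
    and up: "\<forall>\<^sub>F t in at_right 0. \<phi> x - \<phi> (x - t *\<^sub>R q) \<le> t * B t" and B: "(B \<longlongrightarrow> b) (at_right 0)"
  shows "g \<bullet> q \<le> b"
proof -
  have "((\<lambda>t. (\<phi> (x - t *\<^sub>R q) - \<phi> x) / t) \<longlongrightarrow> - (q \<bullet> g)) (at 0)"
    using gderiv_directional[OF assms(1), of "- q"] by (simp add: inner_commute)
  then have "((\<lambda>t. - ((\<phi> (x - t *\<^sub>R q) - \<phi> x) / t)) \<longlongrightarrow> q \<bullet> g) (at_right 0)"
    using tendsto_minus tendsto_within_subset[of _ _ 0 UNIV "{0<..}"] by fastforce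
  from B this show ?thesis
    unfolding inner_commute[of g]
  proof (rule tendsto_le[OF trivial_limit_at_right_real])
    show "\<forall>\<^sub>F t in at_right 0. - ((\<phi> (x - t *\<^sub>R q) - \<phi> x) / t) \<le> B t"
      using up eventually_at_right_less[of "0::real"]
      by eventually_elim (simp add: field_simps)
  qed
qed

context superlinear_hamiltonian
begin

text \<open>
  When \<open>max min H\<close> is at most \<open>0\<close>, the Hamiltonian is at most \<open>- \<delta>\<close> near infinity for
  small momenta. Inserting momenta of norm \<open>\<epsilon>\<close> parallel to \<open>q\<close> in the definition of \<open>L\<close> gives the lower bound.
\<close>
lemma strict_at_infinityD:
  assumes "strict_at_infinity H" and neg: "(SUP x. INF p. ereal (H (x, p))) \<le> 0"
  obtains \<epsilon> \<delta> R0 where "\<epsilon> > 0" "\<delta> > 0" "R0 > 0"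
    "\<And>x p. norm x \<ge> R0 \<Longrightarrow> norm p \<le> \<epsilon> \<Longrightarrow> H (x, p) \<le> - \<delta>"
    "\<And>x q. norm x \<ge> R0 \<Longrightarrow> L (x, q) \<ge> \<epsilon> * norm q + \<delta>"
proof -
  obtain e where e: "e > 0" "Limsup at_infinity (\<lambda>x. SUP p\<in>ball 0 e. ereal (H (x, p))) < 0"
    using assms unfolding strict_at_infinity_def by (meson less_le_trans)
  then obtain b :: ereal where b: "Limsup at_infinity (\<lambda>x. SUP p\<in>ball 0 e. ereal (H (x, p))) < b" "b < 0"
    using dense by blast
  have "b \<noteq> - \<infinity>" using b(1) by auto
  then obtain b' where b': "b = ereal b'" using b(2) by (cases b) auto
  define \<delta> where "\<delta> = - b'"
  have \<delta>: "\<delta> > 0" using b(2) by (simp add: \<delta>_def b')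
  have "\<forall>\<^sub>F x in at_infinity. (SUP p\<in>ball 0 e. ereal (H (x, p))) < b"
    by (rule Limsup_lessD[OF b(1)])
  then obtain R where R: "\<And>x. norm x \<ge> R \<Longrightarrow> (SUP p\<in>ball 0 e. ereal (H (x, p))) < b"
    by (auto simp: eventually_at_infinity)
  have Hle: "H (x, p) \<le> - \<delta>" if "norm x \<ge> max 1 R" "norm p \<le> e / 2" for x p
  proof -
    have "ereal (H (x, p)) \<le> (SUP p\<in>ball 0 e. ereal (H (x, p)))"
      using that e(1) by (intro SUP_upper) auto
    also have "\<dots> < b" using that by (intro R) auto
    finally show ?thesis by (simp add: b' \<delta>_def)
  qed
  show ?thesis
  proof (rule that[of "e / 2" \<delta> "max 1 R"])
    fix x q :: "real ^ 'n" assume x: "norm x \<ge> max 1 R"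
    define p where "p = (e / 2 / norm q) *\<^sub>R q"
    have "norm p \<le> e / 2" "p \<bullet> q = e / 2 * norm q"
      using e(1) by (auto simp: p_def dot_square_norm power2_eq_square)
    then show "L (x, q) \<ge> e / 2 * norm q + \<delta>"
      using fenchel[of p q x] Hle[OF x, of p] by linarith
  qed (use e \<delta> Hle in auto)
qed

text \<open>
  If all closed chains in the ball of radius \<open>R\<close> had nonnegative action for \<open>L + a\<close>, the least action
  \<open>w\<close> of chains from \<open>0\<close> would be finite there. Outside radius \<open>r\<close> it grows at least with slope \<open>\<epsilon>\<close>, whereas
  the cone \<open>\<kappa>\<close> starts above \<open>w\<close> and has slope \<open>\<epsilon> / 2\<close>; their graphs therefore cross before the radius \<open>R1\<close>. The
  function \<open>v\<close>, the minimum of both, still satisfies the step inequality, because where the cone is the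
  smaller one the action of a step dominates the growth of the cone. So \<open>v\<close> would be a
  viscosity subsolution at the negative level \<open>a\<close>. The radii depend only on \<open>\<epsilon>\<close>, \<open>R0\<close> and the bound
  \<open>C\<close> for unit velocities, so \<open>M\<close> can be chosen after \<open>R\<close>.
\<close>
lemma negative_closed_chain:
  assumes no_subsolution: "\<And>a u. a < 0 \<Longrightarrow> \<not> viscosity_subsolution H a u"
    and \<epsilon>: "\<epsilon> > 0" and \<delta>: "\<delta> > 0" and R0: "R0 > 0"
    and H_out: "\<And>x p. norm x \<ge> R0 \<Longrightarrow> norm p \<le> \<epsilon> \<Longrightarrow> H (x, p) \<le> - \<delta>"
    and L_out: "\<And>x q. norm x \<ge> R0 \<Longrightarrow> L (x, q) \<ge> \<epsilon> * norm q + \<delta>"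
  shows "\<exists>R M. M \<ge> 1 \<and> (\<forall>a \<tau>. - \<delta> \<le> a \<and> a < 0 \<and> 0 < \<tau> \<and> \<tau> * M \<le> 1 \<longrightarrow>
      (\<exists>x l. chain \<tau> R M x l x \<and> chain_sum (\<lambda>z. L z + a) l < 0))"
proof -
  have Lbound: "\<exists>C>0. \<forall>z q. norm z \<le> r \<longrightarrow> norm q = 1 \<longrightarrow> L (z, q) \<le> C" for r
  proof -
    have "compact (L ` (cball 0 r \<times> sphere 0 1))"
      by (intro compact_continuous_image compact_Times continuous_on_subset[OF continuous_lagrangian]) auto
    then obtain B where "\<forall>z \<in> cball 0 r \<times> sphere 0 1. \<bar>L z\<bar> \<le> B"
      using compact_imp_bounded[of "L ` (cball 0 r \<times> sphere 0 1)"] unfolding bounded_real by blast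
    then show ?thesis by (intro exI[of _ "max B 1"]) (auto simp: abs_le_iff le_max_iff_disj)
  qed
  define r where "r = R0 + 1"
  obtain C where C: "C > 0" "\<And>z q. norm z \<le> r \<Longrightarrow> norm q = 1 \<Longrightarrow> L (z, q) \<le> C"
    using Lbound[of r] by blast
  have r: "r > 0" using R0 by (simp add: r_def)
  \<comment> \<open>Large enough for \<open>\<epsilon> * (R1 - r) - C * r > C * r + \<epsilon> / 2 * R1\<close>, the lower bound for \<open>w\<close> against the cone.\<close>
  define R1 where "R1 = r + (4 * C * r + 2 * \<epsilon> * r) / \<epsilon> + 1"
  define R where "R = R1 + 1"
  have "0 < (4 * C * r + 2 * \<epsilon> * r) / \<epsilon>"
    using C(1) r \<epsilon> by (intro divide_pos_pos add_pos_pos mult_pos_pos) auto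
  then have R1: "r < R1" "R1 < R" by (auto simp: R1_def R_def)
  obtain CR where CR: "CR > 0" "\<And>z q. norm z \<le> R \<Longrightarrow> norm q = 1 \<Longrightarrow> L (z, q) \<le> CR"
    using Lbound[of R] by blast
  obtain M where M: "M \<ge> 1" "\<And>x p a. norm x \<le> R \<Longrightarrow> a \<le> 0 \<Longrightarrow> (\<And>q. norm q \<le> M \<Longrightarrow> p \<bullet> q \<le> L (x, q) + a) \<Longrightarrow> H (x, p) \<le> a"
    using bounded_velocities_suffice[of R] by blast
  show ?thesis
  proof (intro exI[of _ R] exI[of _ M] conjI M(1) allI impI, elim conjE)
    fix a \<tau> :: real assume a: "- \<delta> \<le> a" "a < 0" and \<tau>: "0 < \<tau>" "\<tau> * M \<le> 1"
    show "\<exists>x l. chain \<tau> R M x l x \<and> chain_sum (\<lambda>z. L z + a) l < 0"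
    proof (rule ccontr)
      assume "\<not> ?thesis"
      then have loops: "0 \<le> chain_sum (\<lambda>z. L z + a) l" if "chain \<tau> R M x l x" for x l
        using that by force
      let ?S = "chain_sum (\<lambda>z. L z + a)"
      have step_le1: "t * norm q \<le> 1" if "0 < t" "t \<le> \<tau>" "norm q \<le> M" for t and q :: "real^'n"
        using mult_mono[of t \<tau> "norm q" M] that \<tau> by auto
      have short: "\<exists>l. chain \<tau> R M x l y \<and> ?S l \<le> C * norm (y - x)" if "norm x \<le> r" "norm y \<le> r" for x y
        using straight_chain[of x r y R M \<tau> "\<lambda>z. L z + a" C] that R1 M(1) \<tau> C(2) a(2) by (smt (verit, best))
      have long: "\<exists>l. chain \<tau> R M x l y \<and> ?S l \<le> CR * norm (y - x)" if "norm x \<le> R" "norm y \<le> R" for x y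
        using straight_chain[of x R y R M \<tau> "\<lambda>z. L z + a" CR] that R1 M(1) \<tau> CR(2) a(2) by (smt (verit, best))
      have outside: "\<epsilon> * norm q \<le> L (y, q) + a" if "norm y \<ge> R0" for y q
        using L_out[OF that, of q] a(1) by linarith
      \<comment> \<open>A chain that ends near the origin can be closed by a segment of bounded cost.\<close>
      have lower_in: "- C * r \<le> ?S l" if l: "chain \<tau> R M 0 l x" and x: "norm x \<le> r" for l x
      proof -
        obtain l' where l': "chain \<tau> R M x l' 0" "?S l' \<le> C * norm (0 - x)"
          using short[OF x, of 0] r by auto
        have "0 \<le> ?S (l @ l')" by (rule loops[OF chain_append[OF l l'(1)]])
        moreover have "C * norm (0 - x) \<le> C * r" using x C(1) by simp
        ultimately show ?thesis using l'(2) by simp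
      qed
      \<comment> \<open>A step that ends beyond \<open>r = R0 + 1\<close> has length at most 1, hence starts where \<open>L + a\<close> dominates \<open>\<epsilon> * norm q\<close>.\<close>
      have lower: "\<epsilon> * (norm x - r) - C * r \<le> ?S l" if l: "chain \<tau> R M z l x" "z = 0" for l x z
        using l
      proof (induction rule: chain.induct)
        case (empty x)
        have "0 \<le> C * r" "0 \<le> \<epsilon> * r" using C(1) r \<epsilon> by auto
        then show ?case using empty by simp
      next
        case (step x l y q t)
        show ?case
        proof (cases "norm (y + t *\<^sub>R q) \<le> r")
          case True
          have "- C * r \<le> ?S (l @ [(y, q, t)])"
            using lower_in[OF _ True] chain.step[OF step.hyps] step.prems by blast
          moreover have "\<epsilon> * (norm (y + t *\<^sub>R q) - r) \<le> 0" using True \<epsilon> by (simp add: mult_le_0_iff)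
          ultimately show ?thesis by linarith
        next
          case False
          have tri: "norm (y + t *\<^sub>R q) \<le> norm y + t * norm q"
            using norm_triangle_ineq[of y "t *\<^sub>R q"] step.hyps by simp
          then have "norm y \<ge> R0"
            using False step_le1[OF step.hyps(3,4,2)] by (simp add: r_def)
          then have "t * (\<epsilon> * norm q) \<le> t * (L (y, q) + a)"
            using step.hyps outside by (intro mult_left_mono) auto
          moreover have "\<epsilon> * norm (y + t *\<^sub>R q) \<le> \<epsilon> * (norm y + t * norm q)"
            using tri \<epsilon> by simp
          ultimately show ?thesis using step.IH step.prems by (simp add: algebra_simps)
        qed
      qed
      define W where "W x = {?S l |l. chain \<tau> R M 0 l x}" for x
      define w where "w x = Inf (W x)" for x
      have W_bdd: "bdd_below (W x)" for x
        by (rule bdd_belowI[of _ "\<epsilon> * (norm x - r) - C * r"]) (auto simp: W_def lower)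
      have W_ne: "W x \<noteq> {}" if "norm x \<le> R" for x
        using long[of 0 x] that R1 r by (auto simp: W_def)
      have w_lower: "\<epsilon> * (norm x - r) - C * r \<le> w x" if "norm x \<le> R" for x
        unfolding w_def by (rule cInf_greatest[OF W_ne[OF that]]) (auto simp: W_def lower)
      have w_upper: "w x \<le> C * r" if x: "norm x \<le> r" for x
      proof -
        obtain l where l: "chain \<tau> R M 0 l x" "?S l \<le> C * norm (x - 0)"
          using short[of 0 x] x r by auto
        have "w x \<le> ?S l" unfolding w_def by (rule cInf_lower[OF _ W_bdd]) (use l in \<open>auto simp: W_def\<close>)
        also have "\<dots> \<le> C * r" using x C(1) by (intro order_trans[OF l(2)]) simp
        finally show ?thesis .
      qed
      have w_chain: "w y \<le> w x + ?S l" if l: "chain \<tau> R M x l y" and x: "norm x \<le> R" for x y l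
      proof -
        have "w y - ?S l \<le> w x"
          unfolding w_def[of x]
        proof (rule cInf_greatest[OF W_ne[OF x]])
          fix s assume "s \<in> W x"
          then obtain l' where l': "chain \<tau> R M 0 l' x" "s = ?S l'" by (auto simp: W_def)
          have "w y \<le> ?S (l' @ l)" unfolding w_def
            using chain_append[OF l'(1) l] by (intro cInf_lower[OF _ W_bdd]) (unfold W_def, blast)
          then show "w y - ?S l \<le> s" using l'(2) by simp
        qed
        then show ?thesis by simp
      qed
      have w_step: "w (y + t *\<^sub>R q) \<le> w y + t * (L (y, q) + a)"
        if "norm y \<le> R" "norm (y + t *\<^sub>R q) \<le> R" "norm q \<le> M" "0 < t" "t \<le> \<tau>" for y q t
              proof -
        have "chain \<tau> R M y ([] @ [(y, q, t)]) (y + t *\<^sub>R q)"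
          using that by (intro chain.step chain.empty)
        from w_chain[OF this that(1)] show ?thesis by simp
      qed
      have w_lip: "\<bar>w x - w y\<bar> \<le> CR * norm (x - y)" if "norm x \<le> R" "norm y \<le> R" for x y
      proof -
        have "w y - w x \<le> CR * norm (x - y)" if xy: "norm x \<le> R" "norm y \<le> R" for x y
        proof -
          obtain l where l: "chain \<tau> R M x l y" "?S l \<le> CR * norm (y - x)" using long[OF xy] by blast
          then show ?thesis
            using w_chain[OF l(1) xy(1)] unfolding norm_minus_commute[of x y] by linarith
        qed
        from this[of x y] this[of y x] that show ?thesis by (simp add: abs_le_iff norm_minus_commute)
      qed
      define \<kappa> where "\<kappa> x = C * r + \<epsilon> / 2 * norm x" for x :: "real^'n"
      have \<kappa>_lip: "\<kappa> (y + t *\<^sub>R q) \<le> \<kappa> y + t * (\<epsilon> / 2 * norm q)" if "0 < t" for y q t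
      proof -
        have "\<epsilon> / 2 * norm (y + t *\<^sub>R q) \<le> \<epsilon> / 2 * (norm y + t * norm q)"
          using norm_triangle_ineq[of y "t *\<^sub>R q"] that \<epsilon> by (intro mult_left_mono) auto
        then show ?thesis by (simp add: \<kappa>_def algebra_simps)
      qed
      have w_below: "w x \<le> \<kappa> x" if "norm x \<le> r" for x
        using w_upper[OF that] \<epsilon> by (simp add: \<kappa>_def add_increasing2)
      have w_above: "\<kappa> x < w x" if "R1 < norm x" "norm x \<le> R" for x
      proof -
        have "\<epsilon> / 2 * R1 = 2 * (C * r) + \<epsilon> * r + \<epsilon> / 2 * (r + 1)"
          using \<epsilon> by (simp add: R1_def field_simps)
        moreover have "0 < \<epsilon> / 2 * (r + 1)" using \<epsilon> r by simp
        ultimately have "\<epsilon> / 2 * R1 > 2 * (C * r) + \<epsilon> * r" by linarith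
        moreover have "\<epsilon> / 2 * R1 \<le> \<epsilon> / 2 * norm x" using that \<epsilon> by (intro mult_left_mono) auto
        ultimately have "\<kappa> x < \<epsilon> * (norm x - r) - C * r"
          by (simp add: \<kappa>_def algebra_simps)
        then show ?thesis using w_lower[OF that(2)] by simp
      qed
      define v where "v x = (if norm x < R then min (w x) (\<kappa> x) else \<kappa> x)" for x
      have v_out: "v x = \<kappa> x" if "norm x > R1" for x
        using w_above[OF that] by (auto simp: v_def)
      have v_step: "v (y + t *\<^sub>R q) \<le> v y + t * (L (y, q) + a)"
        if y: "norm y < R" "norm (y + t *\<^sub>R q) < R" and q: "norm q \<le> M" "0 < t" "t \<le> \<tau>" for y q t
      proof (cases "w y \<le> \<kappa> y")
        case True
        then show ?thesis using w_step[of y t q] y q by (auto simp: v_def)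
      next
        case False
        then have "norm y > r" using w_below[of y] by force
        then have "norm y \<ge> R0" by (simp add: r_def)
        then have "\<epsilon> / 2 * norm q \<le> L (y, q) + a"
          using outside[of y q] mult_nonneg_nonneg[of \<epsilon> "norm q"] \<epsilon> norm_ge_zero[of q] by linarith
        then have "t * (\<epsilon> / 2 * norm q) \<le> t * (L (y, q) + a)"
          using q by (intro mult_left_mono) auto
        then have "\<kappa> (y + t *\<^sub>R q) \<le> \<kappa> y + t * (L (y, q) + a)"
          using \<kappa>_lip[OF q(2), of y q] by linarith
        then show ?thesis using y False by (auto simp: v_def)
      qed
      have "continuous_on (ball 0 R \<union> {x. R1 < norm x}) v"
      proof (rule continuous_on_open_Un)
        have "continuous_on (ball 0 R) w"
        proof (rule lipschitz_on_continuous_on, rule lipschitz_onI)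
          show "dist (w x) (w y) \<le> CR * dist x y" if "x \<in> ball 0 R" "y \<in> ball 0 R" for x y
            using w_lip[of x y] that by (simp add: dist_norm)
        qed (use CR in auto)
        then have "continuous_on (ball 0 R) (\<lambda>x. min (w x) (\<kappa> x))"
          unfolding \<kappa>_def by (intro continuous_intros)
        then show "continuous_on (ball 0 R) v"
          by (subst continuous_on_cong[OF refl, of _ v "\<lambda>x. min (w x) (\<kappa> x)"]) (auto simp: v_def)
        have "continuous_on {x. R1 < norm x} \<kappa>"
          unfolding \<kappa>_def by (intro continuous_intros)
        then show "continuous_on {x. R1 < norm x} v"
          by (subst continuous_on_cong[OF refl, of _ v \<kappa>]) (auto simp: v_out)
        show "open {x::real^'n. R1 < norm x}" by (intro open_Collect_less continuous_intros)
      qed simp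
      moreover have "ball 0 R \<union> {x. R1 < norm x} = (UNIV :: (real^'n) set)" using R1 by auto
      ultimately have v_cont: "continuous_on UNIV v" by simp
      have "viscosity_subsolution H a v"
        unfolding viscosity_subsolution_def
      proof (intro conjI allI impI v_cont)
        fix \<phi> g x
        assume hyp: "(\<forall>y. GDERIV \<phi> y :> g y) \<and> continuous_on UNIV g \<and> (\<forall>\<^sub>F y in nhds x. v y - \<phi> y \<le> v x - \<phi> x)"
        have line: "((\<lambda>t. x - t *\<^sub>R q) \<longlongrightarrow> x) (at_right 0)" for q
          by (rule tendsto_eq_intros refl | simp)+
        have touch: "\<forall>\<^sub>F t in at_right 0. \<phi> x - \<phi> (x - t *\<^sub>R q) \<le> v x - v (x - t *\<^sub>R q)" for q
        proof -
          have "\<forall>\<^sub>F t in at_right 0. v (x - t *\<^sub>R q) - \<phi> (x - t *\<^sub>R q) \<le> v x - \<phi> x"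
            using hyp by (intro eventually_compose_filterlim[OF _ line]) blast
          then show ?thesis by eventually_elim simp
        qed
        show "H (x, g x) \<le> a"
        proof (cases "norm x < R")
          case True
          show ?thesis
          proof (rule M(2))
            fix q :: "real^'n" assume q: "norm q \<le> M"
            have "\<forall>\<^sub>F t in at_right 0. x - t *\<^sub>R q \<in> ball 0 R"
              using line[of q] True by (intro topological_tendstoD[OF line]) auto
            moreover have "\<forall>\<^sub>F t in at_right 0. 0 < t \<and> t \<le> \<tau>"
              using \<tau>(1) by (auto simp: eventually_at_right_field)
            ultimately have "\<forall>\<^sub>F t in at_right 0. \<phi> x - \<phi> (x - t *\<^sub>R q) \<le> t * (L (x - t *\<^sub>R q, q) + a)"
              using touch[of q]
            proof eventually_elim
              case (elim t)
              then show ?case using v_step[of "x - t *\<^sub>R q" t q] True q by simp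
            qed
            moreover have "((\<lambda>t. L (x - t *\<^sub>R q, q) + a) \<longlongrightarrow> L (x, q) + a) (at_right 0)"
              by (intro tendsto_intros continuous_on_tendsto_compose[OF continuous_lagrangian] tendsto_Pair line) auto
            ultimately show "g x \<bullet> q \<le> L (x, q) + a"
              using hyp by (intro gderiv_bound_along) auto
          qed (use True a in auto)
        next
          \<comment> \<open>Here \<open>v\<close> is the cone, whose slope is so small that \<open>H \<le> - \<delta>\<close> at its gradients.\<close>
          case False
          then have x: "R1 < norm x" using R1 by simp
          have "\<forall>\<^sub>F t in at_right 0. x - t *\<^sub>R g x \<in> {x. R1 < norm x}"
            using x by (intro topological_tendstoD[OF line] open_Collect_less continuous_intros) auto
          then have "\<forall>\<^sub>F t in at_right 0. \<phi> x - \<phi> (x - t *\<^sub>R g x) \<le> t * (\<epsilon> / 2 * norm (g x))"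
            using touch[of "g x"] eventually_at_right_less[of "0::real"]
          proof eventually_elim
            case (elim t)
            then show ?case using \<kappa>_lip[of t "x - t *\<^sub>R g x" "g x"] v_out[OF x] v_out[of "x - t *\<^sub>R g x"] by simp
          qed
          then have "g x \<bullet> g x \<le> \<epsilon> / 2 * norm (g x)"
            using hyp by (intro gderiv_bound_along[where B = "\<lambda>_. \<epsilon> / 2 * norm (g x)"]) auto
          then have "norm (g x) * norm (g x) \<le> \<epsilon> / 2 * norm (g x)"
            by (simp add: dot_square_norm power2_eq_square)
          then have "norm (g x) \<le> \<epsilon>"
            using \<epsilon> by (cases "g x = 0") auto
          moreover have "norm x \<ge> R0" using x R1 by (simp add: r_def)
          ultimately show ?thesis using H_out[of x "g x"] a by simp
        qed
      qed
      then show False using no_subsolution a(2) by blast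
    qed
  qed
qed

end

section \<open>Increments of almost-everywhere subsolutions\<close>

text \<open>
  The integrated form of \<open>Du(x) \<bullet> q \<le> \<Phi>(x, q)\<close> that both kinds of subsolutions share. It avoids integrals
  along segments: for short steps and continuous \<open>\<Phi>\<close> the constant \<open>C\<close> can be taken close to \<open>\<Phi> (y, q)\<close>.
\<close>
definition dominated_by :: "('a::real_normed_vector \<Rightarrow> real) \<Rightarrow> ('a \<times> 'a \<Rightarrow> real) \<Rightarrow> bool" where
  "dominated_by u \<Phi> \<longleftrightarrow> (\<forall>y q t r C. 0 < t \<and> t * norm q < r \<and> (\<forall>z\<in>cball y r. \<Phi> (z, q) \<le> C)
     \<longrightarrow> u (y + t *\<^sub>R q) - u y \<le> t * C)"

lemma dominated_byD:
  assumes "dominated_by u \<Phi>" "0 < t" "t * norm q < r" "\<And>z. z \<in> cball y r \<Longrightarrow> \<Phi> (z, q) \<le> C"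
  shows "u (y + t *\<^sub>R q) - u y \<le> t * C"
  using assms unfolding dominated_by_def by blast

text \<open>
  A one-sided mean value inequality in the manner of Dini: at the last point up to which the increment
  is bounded with slope \<open>c'\<close>, a further step with slope at most \<open>c'\<close> is possible.
\<close>
lemma right_increments_bound:
  fixes U :: "real \<Rightarrow> real"
  assumes "0 < t" and cont: "continuous_on {0..t} U"
    and inc: "\<And>s c'. 0 \<le> s \<Longrightarrow> s < t \<Longrightarrow> c < c' \<Longrightarrow> \<exists>h>0. s + h \<le> t \<and> U (s + h) - U s \<le> h * c'"
  shows "U t - U 0 \<le> t * c"
proof (rule ccontr)
  assume "\<not> ?thesis"
  then have "c < (U t - U 0) / t" using assms(1) by (simp add: field_simps)
  then obtain c' where c': "c < c'" "c' < (U t - U 0) / t" using dense by blast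
  define S where "S = {s \<in> {0..t}. U s - U 0 - s * c' \<le> 0}"
  have "closed S"
    unfolding S_def by (intro continuous_closed_preimage_constant continuous_on_closed_Collect_le continuous_intros cont)
  moreover have "0 \<in> S" using assms(1) by (simp add: S_def)
  moreover have bdd: "bdd_above S" by (auto simp: S_def bdd_above_def)
  ultimately have S: "Sup S \<in> S" by (metis closed_contains_Sup empty_iff)
  have "t \<notin> S" using c'(2) assms(1) by (simp add: S_def field_simps)
  with S have "Sup S \<noteq> t" by auto
  with S have "0 \<le> Sup S" "Sup S < t" by (auto simp: S_def)
  then obtain h where h: "h > 0" "Sup S + h \<le> t" "U (Sup S + h) - U (Sup S) \<le> h * c'"
    using inc c'(1) by blast
  have "Sup S + h \<in> S" using h S by (auto simp: S_def algebra_simps)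
  then show False using cSup_upper[OF _ bdd] h(1) by force
qed

lemma locally_Lipschitz_on_compact:
  assumes "locally_Lipschitz u" "compact S"
  obtains K where "K-lipschitz_on S u"
proof -
  have "local_lipschitz {0::real} S (\<lambda>_. u)"
  proof (rule local_lipschitzI)
    fix t x assume "t \<in> {0::real}" "x \<in> S"
    from assms(1) obtain r K where r: "r > 0" "K-lipschitz_on (ball x r) u"
      unfolding locally_Lipschitz_def by blast
    have "K-lipschitz_on (cball x (r / 2) \<inter> S) u"
      by (rule lipschitz_on_subset[OF r(2)]) (use r(1) in auto)
    then show "\<exists>d>0. \<exists>L. \<forall>t\<in>cball t d \<inter> {0}. L-lipschitz_on (cball x d \<inter> S) u"
      using r(1) half_gt_zero by blast
  qed
  then show ?thesis
    using local_lipschitz_compact_implies_lipschitz[where X = S and T = "{0::real}" and f = "\<lambda>_. u"] assms(2) that by auto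
qed

lemma AE_lborel_translate:
  fixes c :: "'a::euclidean_space"
  assumes "AE x in lborel. P x"
  shows "AE x in lborel. P (x + c)"
proof -
  obtain N where N: "{x. \<not> P x} \<subseteq> N" "N \<in> null_sets lborel"
    using AE_E[OF assms] by (auto simp: null_sets_def)
  have "AE x in distr lborel borel ((+) c). x \<notin> N"
    unfolding lborel_distr_plus using N(2) by (rule AE_not_in)
  then have "AE x in lborel. c + x \<notin> N"
    using N(2) by (subst (asm) AE_distr_iff) (auto simp: null_sets_def)
  then show ?thesis
    by eventually_elim (use N(1) in \<open>auto simp: add.commute\<close>)
qed

text \<open>
  The gradient may be undefined along a whole segment, so \<open>u\<close> is averaged: the integral \<open>U s\<close> of
  \<open>u (z + s q)\<close> over \<open>z\<close> in a small ball around \<open>y\<close> sees only almost every point. For each \<open>s\<close> the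
  difference quotients are bounded by the Lipschitz constant and have limits \<open>\<le> C\<close> for almost every \<open>z\<close>, so \<open>U\<close>
  grows at most with slope \<open>C\<close> times the volume. Shrinking the ball gives the claim at \<open>y\<close>.
\<close>
lemma subsolution_for_dominated:
  fixes u :: "real ^ 'n \<Rightarrow> real"
  assumes "subsolution_for \<Phi> u"
  shows "dominated_by u \<Phi>"
  unfolding dominated_by_def
proof (intro allI impI, elim conjE)
  fix y q :: "real ^ 'n" and t r C :: real
  assume t: "0 < t" "t * norm q < r" and C: "\<forall>z\<in>cball y r. \<Phi> (z, q) \<le> C"
  have lip: "locally_Lipschitz u" and ae: "AE x in lborel. \<exists>D. GDERIV u x :> D \<and> (\<forall>q. D \<bullet> q \<le> \<Phi> (x, q))"
    using assms by (auto simp: subsolution_for_def AE_completion_iff)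
  obtain K where K: "K-lipschitz_on (cball y r) u"
    using locally_Lipschitz_on_compact[OF lip compact_cball] .
  have K0: "0 \<le> K" by (rule lipschitz_on_nonneg[OF K])
  have Kd: "\<bar>u a - u b\<bar> \<le> K * norm (a - b)" if "a \<in> cball y r" "b \<in> cball y r" for a b
    using lipschitz_onD[OF K that] by (simp add: dist_norm dist_real_def)
  have avg: "u (y + t *\<^sub>R q) - u y \<le> t * C + 2 * K * \<rho>" if \<rho>: "0 < \<rho>" "\<rho> < r - t * norm q" for \<rho>
  proof -
    define M where "M = restrict_space lborel (ball y \<rho>)"
    have sp: "space M = ball y \<rho>" by (simp add: M_def space_restrict_space)
    have fin: "emeasure lborel (ball y \<rho>) < \<infinity>"
      using emeasure_bounded_finite[OF bounded_ball] by simp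
    interpret M: finite_measure M
      by (rule finite_measureI) (use fin in \<open>simp add: sp, simp add: M_def emeasure_restrict_space\<close>)
    define V where "V = measure M (space M)"
    have "V = measure lborel (ball y \<rho>)"
      by (simp add: V_def sp M_def measure_restrict_space)
    then have V: "V > 0"
      using content_ball_pos[of \<rho> y] \<rho>(1) by simp
    have inball: "z + s *\<^sub>R q \<in> cball y r" if "z \<in> ball y \<rho>" "0 \<le> s" "s \<le> t" for z s
    proof -
      have "norm (z + s *\<^sub>R q - y) \<le> norm (z - y) + norm (s *\<^sub>R q)"
        using norm_triangle_ineq[of "z - y" "s *\<^sub>R q"] by (simp add: algebra_simps)
      also have "norm (s *\<^sub>R q) \<le> t * norm q" using that by (simp add: mult_right_mono)
      finally show ?thesis using that(1) \<rho>(2) by (simp add: dist_norm norm_minus_commute)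
    qed
    have ucont: "continuous_on (cball y r) u" by (rule lipschitz_on_continuous_on[OF K])
    have meas: "(\<lambda>z. u (z + s *\<^sub>R q)) \<in> borel_measurable M" if "0 \<le> s" "s \<le> t" for s
    proof -
      have "continuous_on (ball y \<rho>) (\<lambda>z. u (z + s *\<^sub>R q))"
        by (rule continuous_on_compose2[OF ucont]) (use inball that in \<open>auto intro!: continuous_intros\<close>)
      then have "(\<lambda>z. u (z + s *\<^sub>R q)) \<in> borel_measurable (restrict_space borel (ball y \<rho>))"
        by (rule borel_measurable_continuous_on_restrict)
      moreover have "sets M = sets (restrict_space borel (ball y \<rho>))"
        unfolding M_def by (rule sets_restrict_space_cong) simp
      ultimately show ?thesis by (subst measurable_cong_sets) auto
    qed
    have "0 \<le> t * norm q" using t(1) by simp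
    then have yr: "y \<in> cball y r" using t(2) by (simp only: centre_in_cball)
    have integ: "integrable M (\<lambda>z. u (z + s *\<^sub>R q))" if "0 \<le> s" "s \<le> t" for s
    proof (rule M.integrable_const_bound[OF _ meas[OF that]])
      show "AE z in M. norm (u (z + s *\<^sub>R q)) \<le> \<bar>u y\<bar> + K * r"
      proof (rule AE_I2)
        fix z assume "z \<in> space M"
        then have z: "z + s *\<^sub>R q \<in> cball y r" using inball that by (simp add: sp)
        have "K * norm (z + s *\<^sub>R q - y) \<le> K * r"
          using z K0 by (intro mult_left_mono) (auto simp: dist_norm norm_minus_commute)
        then show "norm (u (z + s *\<^sub>R q)) \<le> \<bar>u y\<bar> + K * r"
          using Kd[OF z yr] by simp
      qed
    qed
    define U where "U s = (\<integral>z. u (z + s *\<^sub>R q) \<partial>M)" for s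
    have Udiff: "U s - U s' = (\<integral>z. u (z + s *\<^sub>R q) - u (z + s' *\<^sub>R q) \<partial>M)"
      if "0 \<le> s" "s \<le> t" "0 \<le> s'" "s' \<le> t" for s s'
      unfolding U_def using integ that by (simp add: Bochner_Integration.integral_diff)
    have quot: "\<bar>u (z + s *\<^sub>R q) - u (z + s' *\<^sub>R q)\<bar> \<le> K * norm q * \<bar>s - s'\<bar>"
      if "z \<in> ball y \<rho>" "0 \<le> s" "s \<le> t" "0 \<le> s'" "s' \<le> t" for z s s'
      using Kd[OF inball[OF that(1,2,3)] inball[OF that(1,4,5)]]
      by (simp add: algebra_simps flip: scaleR_diff_left)
    have "U t - U 0 \<le> t * (C * V)"
    proof (rule right_increments_bound[OF t(1)])
      have "(K * norm q * V)-lipschitz_on {0..t} U"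
      proof (rule lipschitz_onI)
        fix s s' assume s: "s \<in> {0..t}" "s' \<in> {0..t}"
        have "\<bar>U s - U s'\<bar> \<le> (\<integral>z. \<bar>u (z + s *\<^sub>R q) - u (z + s' *\<^sub>R q)\<bar> \<partial>M)"
          using s by (subst Udiff) (auto intro: integral_abs_bound)
        also have "\<dots> \<le> (\<integral>z. K * norm q * \<bar>s - s'\<bar> \<partial>M)"
          using s integ quot by (intro integral_mono) (auto simp: sp)
        finally show "dist (U s) (U s') \<le> K * norm q * V * dist s s'"
          by (simp add: dist_real_def V_def mult_ac)
      qed (use K0 V in auto)
      then show "continuous_on {0..t} U" by (rule lipschitz_on_continuous_on)
      fix s c' assume s: "0 \<le> s" "s < t" and c': "C * V < c'"
      define h where "h n = (t - s) / real (Suc n)" for n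
      have h: "h n > 0" "s + h n \<le> t" for n
      proof -
        show "h n > 0" using s by (simp add: h_def)
        have "h n \<le> (t - s) / 1" unfolding h_def using s by (intro divide_left_mono) auto
        then show "s + h n \<le> t" by simp
      qed
      have "h \<longlonglongrightarrow> 0" unfolding h_def
        by (rule tendsto_divide_0[OF tendsto_const filterlim_at_top_imp_at_infinity])
          (rule filterlim_compose[OF filterlim_real_sequentially filterlim_Suc])
      then have h0: "filterlim h (at 0) sequentially"
        using h(1) by (auto simp: filterlim_at less_imp_neq[symmetric])
      define g where "g n z = (u (z + (s + h n) *\<^sub>R q) - u (z + s *\<^sub>R q)) / h n" for n z
      have gint: "integrable M (g n)" for n
        unfolding g_def using h(1)[of n] h(2)[of n] s by (intro integrable_divide Bochner_Integration.integrable_diff integ) auto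
      have gbound: "\<bar>g n z\<bar> \<le> K * norm q" if "z \<in> ball y \<rho>" for n z
        using quot[OF that, of "s + h n" s] h(1)[of n] h(2)[of n] s
        by (simp add: g_def abs_divide pos_divide_le_eq)
      \<comment> \<open>Truncation below at \<open>C\<close> makes the limit the constant \<open>C\<close>, so no measurable choice of the gradient is needed.\<close>
      have aeM: "AE z in M. (\<lambda>n. max (g n z) C) \<longlonglongrightarrow> C"
      proof -
        have "AE z in lborel. z \<in> ball y \<rho> \<longrightarrow> (\<lambda>n. max (g n z) C) \<longlonglongrightarrow> C"
          using AE_lborel_translate[OF ae, of "s *\<^sub>R q"]
        proof eventually_elim
          case (elim z)
          show ?case
          proof
            assume z: "z \<in> ball y \<rho>"
            from elim obtain D where D: "GDERIV u (z + s *\<^sub>R q) :> D" "D \<bullet> q \<le> \<Phi> (z + s *\<^sub>R q, q)" by auto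
            then have Dq: "D \<bullet> q \<le> C" using C inball[OF z s(1)] s(2) by force
            have "(\<lambda>n. g n z) \<longlonglongrightarrow> D \<bullet> q"
              using filterlim_compose[OF gderiv_directional[OF D(1), of q] h0]
              by (simp add: g_def algebra_simps)
            then have "(\<lambda>n. max (g n z) C) \<longlonglongrightarrow> max (D \<bullet> q) C" by (intro tendsto_intros)
            then show "(\<lambda>n. max (g n z) C) \<longlonglongrightarrow> C" using Dq by simp
          qed
        qed
        then show ?thesis unfolding M_def by (subst AE_restrict_space_iff) auto
      qed
      have "(\<lambda>n. \<integral>z. max (g n z) C \<partial>M) \<longlonglongrightarrow> (\<integral>z. C \<partial>M)"
      proof (rule integral_dominated_convergence[where w = "\<lambda>_. K * norm q + \<bar>C\<bar>"])
        show "AE z in M. norm (max (g n z) C) \<le> K * norm q + \<bar>C\<bar>" for n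
        proof (rule AE_I2)
          fix z assume "z \<in> space M"
          then show "norm (max (g n z) C) \<le> K * norm q + \<bar>C\<bar>"
            using gbound[of z n] by (auto simp: sp)
        qed
      qed (use gint aeM in auto)
      then have "(\<lambda>n. \<integral>z. max (g n z) C \<partial>M) \<longlonglongrightarrow> C * V" by (simp add: V_def mult.commute)
      then have "\<forall>\<^sub>F n in sequentially. (\<integral>z. max (g n z) C \<partial>M) < c'"
        using c' by (rule order_tendstoD)
      then obtain n where n: "(\<integral>z. max (g n z) C \<partial>M) < c'"
        by (auto simp: eventually_sequentially)
      have "U (s + h n) - U s = (\<integral>z. h n * g n z \<partial>M)"
        using s h(1)[of n] h(2)[of n] by (subst Udiff) (auto simp: g_def)
      also have "\<dots> = h n * (\<integral>z. g n z \<partial>M)" by simp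
      also have "\<dots> \<le> h n * c'"
      proof (rule mult_left_mono)
        have "(\<integral>z. g n z \<partial>M) \<le> (\<integral>z. max (g n z) C \<partial>M)"
          using gint by (intro integral_mono) auto
        then show "(\<integral>z. g n z \<partial>M) \<le> c'" using n by simp
      qed (use h(1)[of n] in simp)
      finally show "\<exists>h>0. s + h \<le> t \<and> U (s + h) - U s \<le> h * c'"
        using h[of n] by blast
    qed
    moreover have "(u (y + t *\<^sub>R q) - u y - 2 * K * \<rho>) * V \<le> U t - U 0"
    proof -
      have "(u (y + t *\<^sub>R q) - u y - 2 * K * \<rho>) * V = (\<integral>z. u (y + t *\<^sub>R q) - u y - 2 * K * \<rho> \<partial>M)"
        by (simp add: V_def mult.commute)
      also have "\<dots> \<le> (\<integral>z. u (z + t *\<^sub>R q) - u (z + 0 *\<^sub>R q) \<partial>M)"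
      proof (rule integral_mono)
        fix z assume "z \<in> space M"
        then have z: "z \<in> ball y \<rho>" by (simp add: sp)
        have "y \<in> ball y \<rho>" using \<rho> by simp
        then have "\<bar>u (z + t *\<^sub>R q) - u (y + t *\<^sub>R q)\<bar> \<le> K * norm (z - y)" "\<bar>u z - u y\<bar> \<le> K * norm (z - y)"
          using Kd[OF inball[OF z, of t] inball[of y t]] Kd[OF inball[OF z, of 0] inball[of y 0]] t(1) by auto
        moreover have "K * norm (z - y) \<le> K * \<rho>"
          using z K0 by (intro mult_left_mono) (auto simp: dist_norm norm_minus_commute)
        ultimately show "u (y + t *\<^sub>R q) - u y - 2 * K * \<rho> \<le> u (z + t *\<^sub>R q) - u (z + 0 *\<^sub>R q)"
          by simp
      qed (use integ[of t] integ[of 0] t(1) in auto)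
      also have "\<dots> = U t - U 0" using t(1) by (subst Udiff) auto
      finally show ?thesis .
    qed
    ultimately have "(u (y + t *\<^sub>R q) - u y - 2 * K * \<rho>) * V \<le> (t * C) * V" by (simp add: mult.assoc)
    then show ?thesis using V by simp
  qed
  show "u (y + t *\<^sub>R q) - u y \<le> t * C"
  proof (rule field_le_epsilon)
    fix e :: real assume e: "e > 0"
    define \<rho> where "\<rho> = min ((r - t * norm q) / 2) (e / (2 * K + 1))"
    have "0 < \<rho>" "\<rho> \<le> (r - t * norm q) / 2" unfolding \<rho>_def using t e K0 by simp (rule min.cobounded1)
    moreover have "(r - t * norm q) / 2 < r - t * norm q" using t(2) by simp
    ultimately have \<rho>: "0 < \<rho>" "\<rho> < r - t * norm q" by linarith+
    have "2 * K * \<rho> \<le> (2 * K + 1) * \<rho>" using \<rho>(1) by simp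
    also have "\<dots> \<le> (2 * K + 1) * (e / (2 * K + 1))"
      using K0 by (intro mult_left_mono) (auto simp: \<rho>_def)
    also have "\<dots> = e" using K0 by simp
    finally show "u (y + t *\<^sub>R q) - u y \<le> t * C + e" using avg[OF \<rho>] by simp
  qed
qed

section \<open>Increments of viscosity subsolutions\<close>

lemma touching_point_exists:
  fixes u \<phi> :: "'a::euclidean_space \<Rightarrow> real"
  assumes u: "continuous_on UNIV u" and \<phi>: "\<And>z. GDERIV \<phi> z :> g z"
    and S: "compact S" "z0 \<in> S"
    and bd: "\<And>z. z \<in> S - interior S \<Longrightarrow> u z - \<phi> z < u z0 - \<phi> z0"
  obtains z where "z \<in> S" "\<forall>\<^sub>F y in nhds z. u y - \<phi> y \<le> u z - \<phi> z"
proof -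
  have "continuous_on UNIV \<phi>"
    using \<phi> by (auto simp: gderiv_def continuous_on_eq_continuous_at intro: has_derivative_continuous)
  then have "continuous_on S (\<lambda>z. u z - \<phi> z)"
    using u by (intro continuous_intros) (auto intro: continuous_on_subset)
  then obtain z where z: "z \<in> S" "\<And>y. y \<in> S \<Longrightarrow> u y - \<phi> y \<le> u z - \<phi> z"
    using continuous_attains_sup[OF S(1)] S(2) by blast
  have "z \<in> interior S"
  proof (rule ccontr)
    assume "z \<notin> interior S"
    then have "u z - \<phi> z < u z0 - \<phi> z0" using bd z(1) by simp
    with z(2)[OF S(2)] show False by simp
  qed
  then have "\<forall>\<^sub>F y in nhds z. y \<in> interior S" by (intro eventually_nhds_in_open) auto
  then have "\<forall>\<^sub>F y in nhds z. u y - \<phi> y \<le> u z - \<phi> z"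
    by eventually_elim (use z(2) interior_subset in blast)
  with z(1) show ?thesis using that by blast
qed

text \<open>
  Suppose that \<open>u\<close> increases by more than \<open>t * C\<close> from \<open>y\<close> to \<open>z0 = y + t *\<^sub>R q\<close>. On a thin cylinder around
  the segment, prolonged slightly beyond its end, compare \<open>u\<close> with
  \<open>\<phi> z = c1 * \<sigma> z + exp (\<nu> * (\<sigma> z - (t + d))) + k * (norm (w z))\<^sup>2\<close>, where \<open>\<sigma>\<close> is the time coordinate along \<open>q\<close>, \<open>w\<close>
  is the component orthogonal to \<open>q\<close> and \<open>c1\<close> is slightly larger than \<open>C\<close>. For large \<open>\<nu>\<close> the
  exponential is negligible at \<open>z0\<close> and enormous at the far end; for large \<open>k\<close> the last term is enormous
  on the lateral boundary; and at the near end \<open>u\<close> is about \<open>u y\<close>. So \<open>u - \<phi>\<close> has an interior maximum, where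
  the gradient \<open>g\<close> of \<open>\<phi>\<close> satisfies \<open>g \<bullet> q > c1 > C\<close>, a contradiction. For \<open>q = 0\<close> the claim
  is \<open>C \<ge> 0\<close>, and a touching point anywhere in the ball suffices.
\<close>
lemma touching_gradients_bound_increments:
  fixes u :: "'a::euclidean_space \<Rightarrow> real"
  assumes u: "continuous_on UNIV u"
    and touch: "\<And>\<phi> g z. (\<And>y. GDERIV \<phi> y :> g y) \<Longrightarrow> continuous_on UNIV g \<Longrightarrow>
      \<forall>\<^sub>F y in nhds z. u y - \<phi> y \<le> u z - \<phi> z \<Longrightarrow> z \<in> cball y r \<Longrightarrow> g z \<bullet> q \<le> C"
    and t: "0 < t" "t * norm q < r"
  shows "u (y + t *\<^sub>R q) - u y \<le> t * C"
proof (rule ccontr)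
  assume neg: "\<not> ?thesis"
  have "0 \<le> t * norm q" using t(1) by simp
  then have r: "r > 0" using t(2) by linarith
  have "compact (u ` cball y r)"
    by (intro compact_continuous_image continuous_on_subset[OF u]) auto
  then obtain B where B: "\<And>z. z \<in> cball y r \<Longrightarrow> \<bar>u z\<bar> \<le> B"
    using compact_imp_bounded[of "u ` cball y r"] unfolding bounded_real by blast
  show False
  proof (cases "q = 0")
    case True
    then have Cneg: "C < 0" using neg t(1) by (simp add: not_le mult_less_0_iff zero_less_mult_iff)
    define k where "k = (2 * B + 1) / r\<^sup>2"
    define \<phi> where "\<phi> z = k * ((z - y) \<bullet> (z - y))" for z
    have d: "GDERIV \<phi> z :> (2 * k) *\<^sub>R (z - y)" for z
      unfolding \<phi>_def gderiv_def
      by (auto intro!: derivative_eq_intros simp: inner_commute algebra_simps)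
    obtain z where z: "z \<in> cball y r" "\<forall>\<^sub>F y in nhds z. u y - \<phi> y \<le> u z - \<phi> z"
    proof (rule touching_point_exists[OF u d, of "cball y r" y])
      fix z assume "z \<in> cball y r - interior (cball y r)"
      then have nz: "norm (z - y) = r" "z \<in> cball y r" by (auto simp: dist_norm norm_minus_commute)
      then have "\<phi> z = 2 * B + 1"
        using r by (simp add: \<phi>_def k_def dot_square_norm)
      then show "u z - \<phi> z < u y - \<phi> y"
        using B[OF nz(2)] B[of y] r by (simp add: \<phi>_def)
    qed (use r in auto)
    have "((2 * k) *\<^sub>R (z - y)) \<bullet> q \<le> C"
      by (rule touch[OF d _ z(2,1)]) (intro continuous_intros)
    then show False using True Cneg by simp
  next
    case False
    define \<eta> where "\<eta> = (u (y + t *\<^sub>R q) - u y - t * C) / 4"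
    have \<eta>: "\<eta> > 0" using neg by (simp add: \<eta>_def)
    define c1 where "c1 = C + \<eta> / t"
    have c1: "C < c1" "c1 * t = t * C + \<eta>" using \<eta> t(1) by (auto simp: c1_def field_simps)
    define n where "n = q /\<^sub>R (q \<bullet> q)"
    have qn: "q \<bullet> n = 1" using False by (simp add: n_def)
    define \<sigma> where "\<sigma> z = (z - y) \<bullet> n" for z
    define w where "w z = z - y - \<sigma> z *\<^sub>R q" for z
    have wq: "w z \<bullet> q = 0" for z
      using False by (simp add: w_def \<sigma>_def n_def inner_diff_left)
    define T where "T = (t + r / norm q) / 2"
    have T: "t < T" "T * norm q < r" using False t by (auto simp: T_def field_simps)
    define d where "d = (T - t) / 2"
    have d: "d > 0" using T by (simp add: d_def)
    have "isCont u y" using u by (simp add: continuous_on_eq_continuous_at)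
    then obtain \<rho>0 where \<rho>0: "\<rho>0 > 0" "\<And>z. norm (z - y) < \<rho>0 \<Longrightarrow> \<bar>u z - u y\<bar> < \<eta>"
      using \<eta> unfolding continuous_at_eps_delta dist_norm real_norm_def by blast
    define \<rho> where "\<rho> = min (\<rho>0 / 2) (r - T * norm q)"
    have \<rho>: "\<rho> > 0" "\<rho> < \<rho>0" "T * norm q + \<rho> \<le> r" using \<rho>0(1) T by (auto simp: \<rho>_def)
    \<comment> \<open>Barrier height that beats every value of \<open>u\<close> and of the linear term on the cylinder.\<close>
    define E where "E = 2 * B + \<bar>c1\<bar> * T + 1"
    define \<nu> where "\<nu> = (1 / \<eta> + \<bar>E\<bar>) / d"
    have \<nu>: "\<nu> > 0" using \<eta> d by (simp add: \<nu>_def add_pos_nonneg)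
    have "1 / \<eta> + \<bar>E\<bar> = \<nu> * d" using d by (simp add: \<nu>_def)
    moreover have "\<nu> * d \<le> exp (\<nu> * d)" using exp_ge_add_one_self[of "\<nu> * d"] by linarith
    moreover have "1 / \<eta> > 0" using \<eta> by simp
    ultimately have ex: "1 / \<eta> \<le> exp (\<nu> * d)" "E \<le> exp (\<nu> * d)" by linarith+
    then have exm: "exp (- (\<nu> * d)) \<le> \<eta>"
      using \<eta> by (simp add: exp_minus field_simps)
    define k where "k = \<bar>E\<bar> / \<rho>\<^sup>2"
    define \<phi> where "\<phi> z = c1 * \<sigma> z + exp (\<nu> * (\<sigma> z - (t + d))) + k * (w z \<bullet> w z)" for z
    define g where "g z = (c1 + \<nu> * exp (\<nu> * (\<sigma> z - (t + d)))) *\<^sub>R n + (2 * k) *\<^sub>R w z" for z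
    have gderiv: "GDERIV \<phi> z :> g z" for z
    proof -
      have d\<sigma>: "(\<sigma> has_derivative (\<lambda>h. h \<bullet> n)) (at z)"
        unfolding \<sigma>_def by (auto intro!: derivative_eq_intros)
      have dw: "(w has_derivative (\<lambda>h. h - (h \<bullet> n) *\<^sub>R q)) (at z)"
        unfolding w_def by (auto intro!: derivative_eq_intros d\<sigma>)
      have "(\<phi> has_derivative (\<lambda>h. c1 * (h \<bullet> n) + exp (\<nu> * (\<sigma> z - (t + d))) * (\<nu> * (h \<bullet> n))
          + k * (w z \<bullet> (h - (h \<bullet> n) *\<^sub>R q) + (h - (h \<bullet> n) *\<^sub>R q) \<bullet> w z))) (at z)"
        unfolding \<phi>_def by (auto intro!: derivative_eq_intros d\<sigma> dw)
      moreover have "q \<bullet> w z = 0" using wq[of z] by (simp add: inner_commute)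
      ultimately show ?thesis
        unfolding gderiv_def by (simp add: g_def inner_add_right inner_diff_left inner_commute[of "w z"] algebra_simps)
    qed
    define S where "S = cball y r \<inter> {z. 0 \<le> \<sigma> z \<and> \<sigma> z \<le> T \<and> norm (w z) \<le> \<rho>}"
    have \<sigma>_cont: "continuous_on A \<sigma>" for A unfolding \<sigma>_def by (intro continuous_intros)
    have w_cont: "continuous_on A w" for A unfolding w_def by (intro continuous_intros \<sigma>_cont)
    have comp: "compact S"
      unfolding S_def Collect_conj_eq
      by (intro compact_Int_closed closed_Int closed_Collect_le compact_cball continuous_intros \<sigma>_cont w_cont)
    define z0 where "z0 = y + t *\<^sub>R q"
    have \<sigma>z0: "\<sigma> z0 = t" and wz0: "w z0 = 0" by (simp_all add: z0_def \<sigma>_def w_def qn)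
    have z0: "z0 \<in> S"
      using t T \<rho>(1) by (auto simp: S_def \<sigma>z0 wz0) (auto simp: z0_def dist_norm)
    have val0: "u y + 2 * \<eta> \<le> u z0 - \<phi> z0"
    proof -
      have "\<phi> z0 = t * C + \<eta> + exp (- (\<nu> * d))" by (simp add: \<phi>_def \<sigma>z0 wz0 c1(2))
      moreover have "u z0 = u y + t * C + 4 * \<eta>" by (simp add: \<eta>_def z0_def field_simps)
      ultimately show ?thesis using exm by linarith
    qed
    have B0: "- B \<le> u y" using B[of y] r by (simp add: abs_le_iff)
    obtain z where z: "z \<in> S" "\<forall>\<^sub>F y in nhds z. u y - \<phi> y \<le> u z - \<phi> z"
    proof (rule touching_point_exists[OF u gderiv comp z0])
      fix z assume z: "z \<in> S - interior S"
      have k0: "0 \<le> k * (w z \<bullet> w z)" by (simp add: k_def)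
      have e0: "0 < exp (\<nu> * (\<sigma> z - (t + d)))" by simp
      have zS: "0 \<le> \<sigma> z" "\<sigma> z \<le> T" "norm (w z) \<le> \<rho>" "u z \<le> B"
        using z B[of z] by (auto simp: S_def)
      have "\<bar>c1 * \<sigma> z\<bar> \<le> \<bar>c1\<bar> * T" unfolding abs_mult using zS by (intro mult_left_mono) auto
      then have c1z: "- (\<bar>c1\<bar> * T) \<le> c1 * \<sigma> z" by linarith
      consider "\<sigma> z = 0" | "\<sigma> z = T" | "norm (w z) = \<rho>"
      proof (rule ccontr)
        assume n: "\<not> thesis"
        define O' where "O' = {z. 0 < \<sigma> z \<and> \<sigma> z < T \<and> norm (w z) < \<rho>}"
        have "open O'"
          unfolding O'_def Collect_conj_eq by (intro open_Int open_Collect_less continuous_intros \<sigma>_cont w_cont)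
        moreover have "O' \<subseteq> S"
        proof
          fix x assume x: "x \<in> O'"
          have "norm (x - y) \<le> norm (\<sigma> x *\<^sub>R q) + norm (w x)"
            using norm_triangle_ineq[of "\<sigma> x *\<^sub>R q" "w x"] by (simp add: w_def)
          also have "\<dots> \<le> T * norm q + \<rho>"
            using x by (intro add_mono) (auto simp: O'_def intro!: mult_right_mono)
          finally show "x \<in> S" using x \<rho>(3) by (auto simp: S_def O'_def dist_norm norm_minus_commute)
        qed
        moreover have "z \<in> O'" using n zS that by (force simp: O'_def)
        ultimately show False using z interior_maximal by blast
      qed
      then show "u z - \<phi> z < u z0 - \<phi> z0"
      proof cases
        case 1
        then have "norm (z - y) < \<rho>0" using zS \<rho>(2) by (simp add: w_def)
        then have "u z < u y + \<eta>" using \<rho>0(2)[of z] by linarith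
        moreover have "\<phi> z \<ge> 0" using 1 k0 e0 by (simp add: \<phi>_def)
        ultimately show ?thesis using val0 \<eta> by linarith
      next
        case 2
        then have top: "\<sigma> z - (t + d) = d" by (simp add: d_def field_simps)
        have "\<phi> z = c1 * \<sigma> z + exp (\<nu> * d) + k * (w z \<bullet> w z)" unfolding \<phi>_def top by (rule refl)
        then have "E - \<bar>c1\<bar> * T \<le> \<phi> z" using ex(2) c1z k0 by linarith
        then show ?thesis using zS(4) B0 val0 \<eta> by (simp add: E_def)
      next
        case 3
        then have "k * (w z \<bullet> w z) = \<bar>E\<bar>" using \<rho>(1) by (simp add: k_def dot_square_norm)
        then have "E - \<bar>c1\<bar> * T \<le> \<phi> z" using c1z e0 unfolding \<phi>_def by linarith
        then show ?thesis using zS(4) B0 val0 \<eta> by (simp add: E_def)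
      qed
    qed
    have "g z \<bullet> q \<le> C"
    proof (rule touch[OF gderiv _ z(2)])
      show "continuous_on UNIV g" unfolding g_def by (intro continuous_intros \<sigma>_cont w_cont)
    qed (use z(1) in \<open>simp add: S_def\<close>)
    moreover have "g z \<bullet> q = c1 + \<nu> * exp (\<nu> * (\<sigma> z - (t + d)))"
      by (simp add: g_def inner_add_left wq qn inner_commute[of n])
    moreover have "0 < \<nu> * exp (\<nu> * (\<sigma> z - (t + d)))" using \<nu> by simp
    ultimately show False using c1(1) by linarith
  qed
qed

context superlinear_hamiltonian
begin

lemma viscosity_subsolution_dominated:
  assumes "viscosity_subsolution H a u"
  shows "dominated_by u (\<lambda>z. L z + a)"
  unfolding dominated_by_def
proof (intro allI impI, elim conjE)
  fix y q :: "real ^ 'n" and t r C :: real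
  assume t: "0 < t" "t * norm q < r" and C: "\<forall>z\<in>cball y r. L (z, q) + a \<le> C"
  show "u (y + t *\<^sub>R q) - u y \<le> t * C"
  proof (rule touching_gradients_bound_increments[OF _ _ t])
    show "continuous_on UNIV u" using assms by (simp add: viscosity_subsolution_def)
    fix \<phi> g z
    assume "\<And>y. GDERIV \<phi> y :> g y" "continuous_on UNIV g"
      "\<forall>\<^sub>F y in nhds z. u y - \<phi> y \<le> u z - \<phi> z" and z: "z \<in> cball y r"
    then have "H (z, g z) \<le> a" using assms unfolding viscosity_subsolution_def by blast
    then show "g z \<bullet> q \<le> C" using fenchel[of "g z" q z] C z by fastforce
  qed
qed

end

section \<open>Weak compactness of discrete measures on bounded sets\<close>

lemma binary_expansion:
  fixes y :: real
  assumes "0 \<le> y" "y < 1"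
  obtains d :: "nat \<Rightarrow> real" where "\<And>k. d k \<in> {0, 1}" "(\<lambda>k. d k / 2 ^ Suc k) sums y"
proof
  define d where "d k = real_of_int (\<lfloor>2 ^ Suc k * y\<rfloor> - 2 * \<lfloor>2 ^ k * y\<rfloor>)" for k
  have "\<lfloor>2 * z\<rfloor> - 2 * \<lfloor>z\<rfloor> \<in> {0, 1}" for z :: real
    by (simp, linarith)
  then have "real_of_int (\<lfloor>2 * z\<rfloor> - 2 * \<lfloor>z\<rfloor>) \<in> {0, 1}" for z :: real
    by (metis insert_iff of_int_0 of_int_1 singletonD)
  from this[of "2 ^ k * y" for k] show "d k \<in> {0, 1}" for k
    unfolding d_def power_Suc mult.assoc .
  have partial: "(\<Sum>k<n. d k / 2 ^ Suc k) = \<lfloor>2 ^ n * y\<rfloor> / 2 ^ n" for n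
  proof (induction n)
    case 0
    have "\<lfloor>y\<rfloor> = 0" using assms by linarith
    then show ?case by simp
  next
    case (Suc n)
    then show ?case by (simp add: d_def field_simps)
  qed
  have "(\<lambda>n. \<lfloor>2 ^ n * y\<rfloor> / 2 ^ n) \<longlonglongrightarrow> y"
  proof (rule tendsto_sandwich)
    show "\<forall>\<^sub>F n in sequentially. y - (1 / 2) ^ n \<le> \<lfloor>2 ^ n * y\<rfloor> / 2 ^ n"
    proof (intro always_eventually allI)
      fix n
      have "2 ^ n * y - 1 \<le> \<lfloor>2 ^ n * y\<rfloor>" by linarith
      then have "(2 ^ n * y - 1) / 2 ^ n \<le> \<lfloor>2 ^ n * y\<rfloor> / 2 ^ n"
        by (intro divide_right_mono) auto
      then show "y - (1 / 2) ^ n \<le> \<lfloor>2 ^ n * y\<rfloor> / 2 ^ n"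
        by (simp add: diff_divide_distrib power_one_over)
    qed
    show "\<forall>\<^sub>F n in sequentially. \<lfloor>2 ^ n * y\<rfloor> / 2 ^ n \<le> y"
    proof (intro always_eventually allI)
      fix n
      have "\<lfloor>2 ^ n * y\<rfloor> \<le> 2 ^ n * y" by linarith
      then show "\<lfloor>2 ^ n * y\<rfloor> / 2 ^ n \<le> y"
        by (simp add: field_simps)
    qed
    have "(\<lambda>n. y - (1 / 2) ^ n) \<longlonglongrightarrow> y - 0"
      by (intro tendsto_intros LIMSEQ_realpow_zero) auto
    then show "(\<lambda>n. y - (1 / 2) ^ n) \<longlonglongrightarrow> y" by simp
  qed auto
  then show "(\<lambda>k. d k / 2 ^ Suc k) sums y"
    unfolding sums_def partial .
qed

text \<open>
  The wave of Schoenberg's space-filling curve: continuous, of period 2, equal to 0 on \<open>[0, 1/3]\<close> and to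
  1 on \<open>[2/3, 1]\<close>, so that it reads off ternary digits of points of the Cantor set.
\<close>
definition schoenberg_wave :: "real \<Rightarrow> real" where
  "schoenberg_wave t = max 0 (min 1 (1 / 2 - cos (pi * t)))"

lemma schoenberg_wave_bounds: "0 \<le> schoenberg_wave t" "schoenberg_wave t \<le> 1"
  by (auto simp: schoenberg_wave_def)

lemma continuous_schoenberg_wave [continuous_intros]:
  fixes f :: "real \<Rightarrow> real"
  shows "continuous_on S f \<Longrightarrow> continuous_on S (\<lambda>x. schoenberg_wave (f x))"
  unfolding schoenberg_wave_def by (auto intro!: continuous_intros)

lemma schoenberg_wave_even_int: "schoenberg_wave (2 * real_of_int m + t) = schoenberg_wave t"
proof -
  have "cos (pi * (2 * real_of_int m + t)) = cos (pi * t + 2 * pi * real_of_int m)"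
    by (simp add: algebra_simps)
  also have "\<dots> = cos (pi * t)"
    by (simp add: cos_add sin_integer_2pi cos_integer_2pi)
  finally show ?thesis by (simp add: schoenberg_wave_def)
qed

lemma schoenberg_wave_low: assumes "0 \<le> t" "t \<le> 1/3" shows "schoenberg_wave t = 0"
proof -
  have "cos (pi / 3) \<le> cos (pi * t)"
    using assms by (intro cos_monotone_0_pi_le) (auto simp: field_simps)
  then show ?thesis by (simp add: schoenberg_wave_def cos_60)
qed

lemma schoenberg_wave_high: assumes "2/3 \<le> t" "t \<le> 1" shows "schoenberg_wave t = 1"
proof -
  have "cos (pi / 3) \<le> cos (pi - pi * t)"
    using assms by (intro cos_monotone_0_pi_le) (auto simp: field_simps)
  then have "cos (pi * t) \<le> - (1 / 2)" by (simp add: cos_60)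
  then show ?thesis by (simp add: schoenberg_wave_def)
qed

text \<open>
  Up to an even integer, \<open>3 ^ n * t\<close> is \<open>2 * d n / 3\<close> plus a tail in \<open>[0, 1/3]\<close>.
\<close>
lemma ternary_digits_recovered:
  fixes d :: "nat \<Rightarrow> real"
  assumes d: "\<And>m. d m \<in> {0, 1}"
  defines "t \<equiv> \<Sum>m. 2 * d m / 3 ^ Suc m"
  shows "t \<in> {0..1}" "schoenberg_wave (3 ^ n * t) = d n"
proof -
  have d01: "0 \<le> d m" "d m \<le> 1" for m using d[of m] by auto
  have geo: "(\<lambda>m. 2 * 1 / 3 ^ Suc m) sums (1 :: real)"
    using sums_mult[OF geometric_sums[of "1/3::real"], of "2/3"] by (simp add: field_simps)
  have smb: "summable (\<lambda>m. 2 * e m / 3 ^ Suc m)" 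
    and bnd: "(\<Sum>m. 2 * e m / 3 ^ Suc m) \<in> {0..1}" if "\<And>m. 0 \<le> e m \<and> e m \<le> 1" for e :: "nat \<Rightarrow> real"
  proof -
    have le: "2 * e m / 3 ^ Suc m \<le> 2 * 1 / 3 ^ Suc m" for m
      using that[of m] by (intro divide_right_mono) auto
    show s: "summable (\<lambda>m. 2 * e m / 3 ^ Suc m)"
      by (rule summable_comparison_test'[OF sums_summable[OF geo], of 0])
        (use le that in \<open>auto simp: abs_mult\<close>)
    have "(\<Sum>m. 2 * e m / 3 ^ Suc m) \<le> (\<Sum>m. 2 * 1 / 3 ^ Suc m)"
      by (intro suminf_le le s sums_summable[OF geo])
    moreover have "0 \<le> (\<Sum>m. 2 * e m / 3 ^ Suc m)"
      by (intro suminf_nonneg s) (use that in auto)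
    ultimately show "(\<Sum>m. 2 * e m / 3 ^ Suc m) \<in> {0..1}"
      using sums_unique[OF geo] by simp
  qed
  show "t \<in> {0..1}" unfolding t_def using bnd d01 by blast
  define r where "r = (\<Sum>m. 2 * d (m + Suc n) / 3 ^ Suc m)"
  have r: "r \<in> {0..1}" unfolding r_def using bnd[of "\<lambda>m. d (m + Suc n)"] d01 by blast
  have "t = (\<Sum>m. 2 * d (m + Suc n) / 3 ^ Suc (m + Suc n)) + (\<Sum>m<Suc n. 2 * d m / 3 ^ Suc m)"
    unfolding t_def using smb[of d] d01 by (intro suminf_split_initial_segment) auto
  also have "(\<Sum>m. 2 * d (m + Suc n) / 3 ^ Suc (m + Suc n)) = (\<Sum>m. (1 / 3 ^ Suc n) * (2 * d (m + Suc n) / 3 ^ Suc m))"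
    by (intro suminf_cong) (simp add: power_add field_simps)
  also have "\<dots> = r / 3 ^ Suc n"
    unfolding r_def using smb[of "\<lambda>m. d (m + Suc n)"] d01 by (subst suminf_mult) auto
  finally have "3 ^ n * t = r / 3 + 2 * d n / 3 + (\<Sum>m<n. 3 ^ n * (2 * d m / 3 ^ Suc m))"
    by (simp add: field_simps sum_distrib_left)
  also have "(\<Sum>m<n. 3 ^ n * (2 * d m / 3 ^ Suc m)) = 2 * real_of_int (\<Sum>m<n. 3 ^ (n - Suc m) * \<lfloor>d m\<rfloor>)"
    unfolding of_int_sum sum_distrib_left
  proof (intro sum.cong refl)
    fix m assume "m \<in> {..<n}"
    then have pow: "(3::real) ^ n = 3 ^ (n - Suc m) * 3 ^ Suc m"
      by (metis Suc_leI add.commute le_add_diff_inverse lessThan_iff power_add)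
    have flo: "real_of_int \<lfloor>d m\<rfloor> = d m" using d[of m] by (metis floor_of_int insert_iff of_int_0 of_int_1 singletonD)
    show "3 ^ n * (2 * d m / 3 ^ Suc m) = 2 * real_of_int (3 ^ (n - Suc m) * \<lfloor>d m\<rfloor>)"
      unfolding of_int_mult flo pow by simp
  qed
  finally have *: "3 ^ n * t = 2 * real_of_int (\<Sum>m<n. 3 ^ (n - Suc m) * \<lfloor>d m\<rfloor>) + (r / 3 + 2 * d n / 3)"
    by simp
  show "schoenberg_wave (3 ^ n * t) = d n"
    unfolding * schoenberg_wave_even_int
    using d[of n] r schoenberg_wave_low[of "r / 3"] schoenberg_wave_high[of "r / 3 + 2 / 3"] by auto
qed

text \<open>
  The binary digits of all coordinates of a point are interleaved to ternary digits of a single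
  parameter. The interleaving is by an injective coding \<open>j\<close> of (coordinate, digit) by natural numbers;
  positions outside its range carry the digit 0.
\<close>
lemma ex_space_filling_curve:
  fixes K :: "'a::euclidean_space set"
  assumes "bounded K"
  obtains g :: "real \<Rightarrow> 'a" where "continuous_on UNIV g" "bounded (range g)" "K \<subseteq> g ` {0..1}"
proof -
  obtain c where c: "c > 0" "\<And>x. x \<in> K \<Longrightarrow> norm x < c"
    using assms by (meson bounded_pos_less)
  obtain e :: "'a \<Rightarrow> nat" where e: "inj_on e Basis"
    using finite_imp_inj_to_nat_seg[OF finite_Basis[where 'a='a]] by blast
  define j where "j b k = prod_encode (e b, k)" for b k
  define Y where "Y b t = (\<Sum>k. schoenberg_wave (3 ^ j b k * t) / 2 ^ Suc k)" for b t
  have geo: "(\<lambda>k. 1 / 2 ^ Suc k) sums (1 :: real)"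
    using sums_mult[OF geometric_sums[of "1/2::real"], of "1/2"] by (simp add: field_simps)
  have le: "norm (schoenberg_wave s / 2 ^ Suc k) \<le> 1 / 2 ^ Suc k" for s and k :: nat
    using schoenberg_wave_bounds[of s] by (simp add: field_simps)
  have smb: "summable (\<lambda>k. schoenberg_wave (s k) / 2 ^ Suc k)" for s
    by (rule summable_comparison_test'[OF sums_summable[OF geo], of 0]) (rule le)
  have Y01: "0 \<le> Y b t" "Y b t \<le> 1" for b t
  proof -
    show "0 \<le> Y b t" unfolding Y_def by (intro suminf_nonneg smb) (auto simp: schoenberg_wave_bounds)
    have "Y b t \<le> (\<Sum>k. 1 / 2 ^ Suc k)"
      unfolding Y_def by (intro suminf_le smb sums_summable[OF geo]) (use schoenberg_wave_bounds(2) in \<open>simp add: divide_right_mono\<close>)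
    then show "Y b t \<le> 1" using sums_unique[OF geo] by simp
  qed
  have contY: "continuous_on UNIV (Y b)" for b
  proof (rule uniform_limit_theorem)
    show "uniform_limit UNIV (\<lambda>n t. \<Sum>k<n. schoenberg_wave (3 ^ j b k * t) / 2 ^ Suc k) (Y b) sequentially"
      unfolding Y_def by (rule Weierstrass_m_test[OF le sums_summable[OF geo]])
    show "\<forall>\<^sub>F n in sequentially. continuous_on UNIV (\<lambda>t. \<Sum>k<n. schoenberg_wave (3 ^ j b k * t) / 2 ^ Suc k)"
      by (intro always_eventually allI continuous_intros) auto
  qed simp
  define g where "g t = (\<Sum>b\<in>Basis. (2 * c * Y b t - c) *\<^sub>R b)" for t
  show ?thesis
  proof
    show "continuous_on UNIV g"
      unfolding g_def by (intro continuous_intros contY)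
    show "bounded (range g)"
    proof (rule boundedI)
      fix z assume "z \<in> range g"
      then obtain t where z: "z = g t" by auto
      have "norm z \<le> (\<Sum>b\<in>Basis. norm ((2 * c * Y b t - c) *\<^sub>R (b::'a)))"
        unfolding z g_def by (rule norm_sum)
      also have "\<dots> \<le> (\<Sum>b\<in>(Basis::'a set). c)"
      proof (rule sum_mono)
        fix b :: 'a assume "b \<in> Basis"
        have "c * Y b t \<le> c * 1" "0 \<le> c * Y b t"
          using c(1) Y01[of b t] by (auto intro!: mult_left_mono mult_nonneg_nonneg simp del: mult_1_right)
        then show "norm ((2 * c * Y b t - c) *\<^sub>R b) \<le> c"
          using \<open>b \<in> Basis\<close> by (simp add: abs_le_iff mult.assoc)
      qed
      finally show "norm z \<le> (\<Sum>b\<in>(Basis::'a set). c)" .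
    qed
    show "K \<subseteq> g ` {0..1}"
    proof
      fix x assume x: "x \<in> K"
      define y where "y b = (x \<bullet> b + c) / (2 * c)" for b
      have y01: "0 \<le> y b \<and> y b < 1" if "b \<in> Basis" for b
      proof -
        have "\<bar>x \<bullet> b\<bar> < c" using Basis_le_norm[OF that, of x] c(2)[OF x] by linarith
        then show ?thesis using c(1) by (auto simp: y_def field_simps)
      qed
      have "\<forall>b\<in>Basis. \<exists>d::nat \<Rightarrow> real. (\<forall>k. d k \<in> {0,1}) \<and> (\<lambda>k. d k / 2 ^ Suc k) sums y b"
      proof
        fix b :: 'a assume "b \<in> Basis"
        then obtain d :: "nat \<Rightarrow> real" where "\<And>k. d k \<in> {0, 1}" "(\<lambda>k. d k / 2 ^ Suc k) sums y b"
          using y01[of b] binary_expansion[of "y b"] by blast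
        then show "\<exists>d::nat \<Rightarrow> real. (\<forall>k. d k \<in> {0,1}) \<and> (\<lambda>k. d k / 2 ^ Suc k) sums y b" by blast
      qed
      then obtain d :: "'a \<Rightarrow> nat \<Rightarrow> real" 
        where d: "\<And>b k. b \<in> Basis \<Longrightarrow> d b k \<in> {0,1}" "\<And>b. b \<in> Basis \<Longrightarrow> (\<lambda>k. d b k / 2 ^ Suc k) sums y b"
        by metis
      define D where "D m = (if fst (prod_decode m) \<in> e ` Basis 
        then d (the_inv_into Basis e (fst (prod_decode m))) (snd (prod_decode m)) else 0)" for m
      have D01: "D m \<in> {0,1}" for m
        using d(1) the_inv_into_into[OF e] by (auto simp: D_def)
      have Dj: "D (j b k) = d b k" if "b \<in> Basis" for b k
        using that by (auto simp: D_def j_def the_inv_into_f_f[OF e])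
      define t where "t = (\<Sum>m. 2 * D m / 3 ^ Suc m)"
      have t: "t \<in> {0..1}" "\<And>n. schoenberg_wave (3 ^ n * t) = D n"
        using ternary_digits_recovered[of D] D01 unfolding t_def by auto
      have "Y b t = y b" if "b \<in> Basis" for b
        unfolding Y_def t(2) Dj[OF that] using sums_unique[OF d(2)[OF that]] by simp
      then have "g t = (\<Sum>b\<in>Basis. (x \<bullet> b) *\<^sub>R b)"
        unfolding g_def using c(1) by (intro sum.cong) (auto simp: y_def)
      then have "x = g t" by (simp add: euclidean_representation)
      then show "x \<in> g ` {0..1}" using t(1) by blast
    qed
  qed
qed

text \<open>
  Choosing preimages of the points under a space-filling curve \<open>g\<close> lifts the measures to the unit
  interval, where Helly's selection theorem applies. The image under \<open>g\<close> of a weak limit there is the limit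
  sought: \<open>f \<circ> g\<close> is continuous, and it is bounded even if \<open>f\<close> is not, since \<open>g\<close> has bounded range.
\<close>
theorem discrete_measures_subconverge:
  fixes Z :: "nat \<Rightarrow> nat \<Rightarrow> 'a::euclidean_space" and w :: "nat \<Rightarrow> nat \<Rightarrow> real"
  assumes w: "\<And>n i. i < N n \<Longrightarrow> 0 \<le> w n i" "\<And>n. (\<Sum>i<N n. w n i) = 1"
    and Z: "\<And>n i. i < N n \<Longrightarrow> Z n i \<in> K" and K: "bounded K"
  obtains r :: "nat \<Rightarrow> nat" and \<mu> :: "'a measure"
    where "strict_mono r" "sets \<mu> = sets borel" "prob_space \<mu>"
      "\<And>f :: 'a \<Rightarrow> real. continuous_on UNIV f \<Longrightarrow> integrable \<mu> f \<and>
         (\<lambda>n. \<Sum>i<N (r n). w (r n) i * f (Z (r n) i)) \<longlonglongrightarrow> (\<integral>z. f z \<partial>\<mu>)"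
proof -
  obtain g :: "real \<Rightarrow> 'a" where g: "continuous_on UNIV g" "bounded (range g)" "K \<subseteq> g ` {0..1}"
    using ex_space_filling_curve[OF K] .
  have "\<forall>n i. \<exists>s. i < N n \<longrightarrow> s \<in> {0..1} \<and> g s = Z n i"
    using Z g(3) by (metis image_iff subsetD)
  then obtain s where s: "\<And>n i. i < N n \<Longrightarrow> s n i \<in> {0..1}" "\<And>n i. i < N n \<Longrightarrow> g (s n i) = Z n i"
    by metis
  define P where "P n = point_measure {..<N n} (\<lambda>i. ennreal (w n i))" for n
  define \<nu> where "\<nu> n = distr (P n) borel (s n)" for n
  have P: "prob_space (P n)" for n
    unfolding P_def
  proof (rule prob_space_point_measure)
    have "(\<Sum>i\<in>{..<N n}. ennreal (w n i)) = ennreal (\<Sum>i<N n. w n i)"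
      using w(1) by (intro sum_ennreal) auto
    then show "(\<Sum>i\<in>{..<N n}. ennreal (w n i)) = 1" using w(2) by simp
  qed (use w in auto)
  have sm: "h \<in> borel_measurable (P n)" for n and h :: "nat \<Rightarrow> real"
    unfolding P_def by (simp add: measurable_point_measure_eq1)
  have rd: "real_distribution (\<nu> n)" for n
    unfolding \<nu>_def real_distribution_def real_distribution_axioms_def
    by (simp add: prob_space.prob_space_distr[OF P] sm)
  have int\<nu>: "(\<integral>x. f x \<partial>\<nu> n) = (\<Sum>i<N n. w n i * f (s n i))" if "f \<in> borel_measurable borel" for f :: "real \<Rightarrow> real" and n
  proof -
    have "(\<integral>x. f x \<partial>\<nu> n) = (\<integral>i. f (s n i) \<partial>P n)"
      unfolding \<nu>_def by (rule integral_distr) (use that sm in auto)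
    also have "\<dots> = (\<Sum>i<N n. w n i * f (s n i))"
      unfolding P_def using w(1) by (subst lebesgue_integral_point_measure_finite) auto
    finally show ?thesis .
  qed
  have "measure (\<nu> n) {-1<..1} = 1" for n
  proof -
    have "measure (\<nu> n) {-1<..1} = measure (P n) (s n -` {-1<..1} \<inter> space (P n))"
      unfolding \<nu>_def by (rule measure_distr) (auto simp: sm)
    also have "s n -` {-1<..1} \<inter> space (P n) = space (P n)"
      using s(1)[of _ n] by (force simp: P_def space_point_measure)
    finally show ?thesis using prob_space.prob_space[OF P] by simp
  qed
  then have "tight \<nu>"
    unfolding tight_def using rd by (intro conjI allI impI exI[of _ "-1::real"] exI[of _ "1::real"]) auto
  from tight_imp_convergent_subsubsequence[OF this strict_mono_id]
  obtain r M where r: "strict_mono r" and M: "real_distribution M" and conv: "weak_conv_m (\<nu> \<circ> r) M"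
    by (auto simp: id_def comp_def)
  interpret M: real_distribution M by (rule M)
  have gm: "g \<in> borel_measurable borel" using g(1) by (rule borel_measurable_continuous_onI)
  define \<mu> where "\<mu> = distr M borel g"
  show ?thesis
  proof
    show "strict_mono r" by fact
    show "sets \<mu> = sets borel" by (simp add: \<mu>_def)
    show "prob_space \<mu>" unfolding \<mu>_def by (rule M.prob_space_distr) (use gm in simp)
    fix f :: "'a \<Rightarrow> real" assume f: "continuous_on UNIV f"
    have fm: "f \<in> borel_measurable borel" using f by (rule borel_measurable_continuous_onI)
    have fg: "continuous_on UNIV (\<lambda>x. f (g x))"
      using continuous_on_compose2[OF f g(1)] by simp
    have "bounded (f ` closure (range g))"
      using g(2) by (intro compact_imp_bounded compact_continuous_image continuous_on_subset[OF f]) (auto simp: compact_closure)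
    then obtain B where B: "\<And>x. \<bar>f (g x)\<bar> \<le> B"
      unfolding bounded_real using closure_subset by (metis imageI rangeI subsetD)
    have "integrable M (\<lambda>x. f (g x))"
      by (rule M.integrable_const_bound[of _ B]) (use B fm gm in auto)
    then have "integrable \<mu> f"
      unfolding \<mu>_def by (subst integrable_distr_eq) (use fm gm in auto)
    moreover have "(\<lambda>n. integral\<^sup>L ((\<nu> \<circ> r) n) (\<lambda>x. f (g x))) \<longlonglongrightarrow> integral\<^sup>L M (\<lambda>x. f (g x))"
      by (rule weak_conv_imp_integral_bdd_continuous_conv[OF _ M conv, of _ B])
        (use rd fg B in \<open>auto simp: continuous_on_eq_continuous_at\<close>)
    moreover have "integral\<^sup>L M (\<lambda>x. f (g x)) = (\<integral>z. f z \<partial>\<mu>)"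
      unfolding \<mu>_def by (subst integral_distr) (use fm gm in auto)
    moreover have "integral\<^sup>L ((\<nu> \<circ> r) n) (\<lambda>x. f (g x)) = (\<Sum>i<N (r n). w (r n) i * f (Z (r n) i))" for n
      using int\<nu>[of "\<lambda>x. f (g x)" "r n"] fm gm s(2) by simp
    ultimately show "integrable \<mu> f \<and>
         (\<lambda>n. \<Sum>i<N (r n). w (r n) i * f (Z (r n) i)) \<longlonglongrightarrow> (\<integral>z. f z \<partial>\<mu>)" by simp
  qed
qed

section \<open>Occupation measures of closed chains and their limit\<close>

lemma chain_sum_add_const:
  "chain_sum (\<lambda>z. F z + c) l = chain_sum F l + c * chain_sum (\<lambda>_. 1) l"
  by (induction l rule: rev_induct) (auto simp: chain_sum_def algebra_simps)

lemma chain_sum_conv_sum: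
  "chain_sum F l = (\<Sum>i<length l. snd (snd (l ! i)) * F (fst (l ! i), fst (snd (l ! i))))"
  unfolding chain_sum_def sum_list_sum_nth
  by (simp add: atLeast0LessThan case_prod_unfold)

text \<open>
  Around a closed chain the increments of \<open>u\<close> cancel. The term \<open>\<eta>\<close> pays for the variation of \<open>\<Phi>\<close> along a
  step, which is small once the steps are short.
\<close>
lemma closed_chain_sum_nonneg:
  fixes u :: "'a::euclidean_space \<Rightarrow> real"
  assumes dom: "dominated_by u \<Phi>" and cont: "continuous_on UNIV \<Phi>" and \<eta>: "\<eta> > 0" and M: "M > 0"
  obtains \<tau>0 where "\<tau>0 > 0" 
    "\<And>\<tau> (x :: 'a) l. \<tau> \<le> \<tau>0 \<Longrightarrow> chain \<tau> R M x l x \<Longrightarrow> 0 \<le> chain_sum (\<lambda>z. \<Phi> z + \<eta>) l"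
proof -
  define K where "K = cball (0::'a) (R + 1) \<times> cball (0::'a) M"
  have "compact K" unfolding K_def by (intro compact_Times) auto
  then have "uniformly_continuous_on K \<Phi>"
    using cont by (intro compact_uniformly_continuous) (auto intro: continuous_on_subset)
  then obtain d where d: "d > 0" "\<And>z z'. z \<in> K \<Longrightarrow> z' \<in> K \<Longrightarrow> dist z' z < d \<Longrightarrow> dist (\<Phi> z') (\<Phi> z) < \<eta>"
    unfolding uniformly_continuous_on_def using \<eta> by metis
  define r where "r = min 1 (d / 2)"
  have r: "0 < r" "r \<le> 1" "r < d" using d(1) by (auto simp: r_def)
  show ?thesis
  proof
    show "r / (2 * M) > 0" using r M by simp
    fix \<tau> and x :: 'a and l assume \<tau>: "\<tau> \<le> r / (2 * M)" and l: "chain \<tau> R M x l x"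
    have "u (z + t *\<^sub>R q) - u z \<le> t * (\<Phi> (z, q) + \<eta>)"
      if z: "norm z \<le> R" and q: "norm q \<le> M" and t: "0 < t" "t \<le> \<tau>" for z q t
    proof -
      have "t * norm q \<le> r / (2 * M) * M" using q t \<tau> M by (intro mult_mono) auto
      also have "\<dots> < r" using r M by simp
      finally have "t * norm q < r" .
      moreover have "\<Phi> (z', q) \<le> \<Phi> (z, q) + \<eta>" if z': "z' \<in> cball z r" for z'
      proof -
        have "norm z' \<le> norm z + norm (z' - z)" by norm
        also have "\<dots> \<le> R + 1" using z z' r by (simp add: dist_norm norm_minus_commute)
        finally have "dist (\<Phi> (z', q)) (\<Phi> (z, q)) < \<eta>"
          using z z' q r by (intro d(2)) (auto simp: K_def dist_Pair_Pair dist_commute)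
        then show ?thesis by (simp add: dist_real_def)
      qed
      ultimately show ?thesis using dominated_byD[OF dom t(1)] by blast
    qed
    from chain_telescope[OF l, of u "\<lambda>z. \<Phi> z + \<eta>"] this
    show "0 \<le> chain_sum (\<lambda>z. \<Phi> z + \<eta>) l" by simp
  qed
qed

lemma pairing_eq_integral:
  assumes "integrable \<mu> f"
  shows "pairing \<mu> f = ereal (\<integral>z. f z \<partial>\<mu>)"
proof -
  obtain a b where ab: "0 \<le> a" "0 \<le> b" "(\<integral>\<^sup>+ z. ennreal (f z) \<partial>\<mu>) = ennreal a" "(\<integral>\<^sup>+ z. ennreal (- f z) \<partial>\<mu>) = ennreal b"
    "(\<integral>z. f z \<partial>\<mu>) = a - b"
    using integrableE[OF assms] by metis
  show ?thesis unfolding pairing_def ab(3,4,5) using ab(1,2) by (simp add: enn2ereal_ennreal)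
qed

context superlinear_hamiltonian
begin

text \<open>
  Domination with \<open>q = 0\<close> gives \<open>L (x, 0) + a \<ge> 0\<close> for levels \<open>a\<close> of subsolutions, which may be taken below any
  positive bound, and \<open>L (x, 0)\<close> is minus the minimum of \<open>H (x, _)\<close>.
\<close>
lemma min_hamiltonian_nonpos:
  assumes subsol: "\<And>\<eta>. \<eta> > 0 \<Longrightarrow> \<exists>a<\<eta>. \<exists>u. viscosity_subsolution H a u"
  shows "(SUP x. INF p. ereal (H (x, p))) \<le> 0"
proof (rule SUP_least)
  fix x
  have L0: "0 \<le> L (x, 0)"
  proof (rule field_le_epsilon)
    fix e :: real assume e: "e > 0"
    obtain a u where a: "a < e / 2" "viscosity_subsolution H a u" using subsol[of "e / 2"] e by auto
    have "((\<lambda>z. L (z, 0)) \<longlongrightarrow> L (x, 0)) (nhds x)"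
      by (intro continuous_on_tendsto_compose[OF continuous_lagrangian] tendsto_Pair tendsto_const filterlim_ident) auto
    then have "\<forall>\<^sub>F z in nhds x. L (z, 0) < L (x, 0) + e / 2"
      using e by (intro order_tendstoD(2)) auto
    then obtain r where r: "r > 0" "\<And>z. z \<in> cball x r \<Longrightarrow> L (z, 0) < L (x, 0) + e / 2"
      unfolding eventually_nhds_metric_le by (auto simp: dist_commute)
    have "u (x + 1 *\<^sub>R 0) - u x \<le> 1 * (L (x, 0) + e / 2 + a)"
      by (rule dominated_byD[OF viscosity_subsolution_dominated[OF a(2)], of _ _ r]) (use r in \<open>auto intro: less_imp_le\<close>)
    then show "0 \<le> L (x, 0) + e" using a(1) by simp
  qed
  show "(INF p. ereal (H (x, p))) \<le> 0"
  proof (rule ccontr)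
    assume "\<not> ?thesis"
    then obtain e where e: "0 < ereal e" "ereal e < (INF p. ereal (H (x, p)))"
      using ereal_dense2 by (metis not_le)
    then have "e \<le> H (x, p)" for p
      by (metis INF_lower UNIV_I ereal_less_eq(3) less_imp_le order_trans)
    then have "L (x, 0) \<le> - e" by (intro lagrangian_leI) simp
    then show False using L0 e(1) by simp
  qed
qed

end

theorem theorem8p1:
  fixes H :: "(real ^ 'n) \<times> (real ^ 'n) \<Rightarrow> real"
  assumes "continuous_on UNIV H"
    and "coercive_convex H"
    and "strict_at_infinity H"
    and "superlinear H"
    and "critical_value H = 0"
  shows "\<exists>\<mu> :: ((real ^ 'n) \<times> (real ^ 'n)) measure.
           radon_probability \<mu> \<and>
           pairing \<mu> (lagrangian H) = 0 \<and>
           (\<forall>\<Phi>. continuous_on UNIV \<Phi> \<and> bdd_below (range \<Phi>) \<and> (\<exists>u. subsolution_for \<Phi> u) \<longrightarrow>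
              pairing \<mu> \<Phi> \<ge> pairing \<mu> (lagrangian H))"
proof -
  interpret superlinear_hamiltonian H
  proof
    show "convex_on UNIV (\<lambda>p. H (x, p))" for x using assms(2) by (simp add: coercive_convex_def)
  qed fact+
  have no_subsol: "\<not> viscosity_subsolution H a u" if "a < 0" for a u
  proof
    assume "viscosity_subsolution H a u"
    then have "critical_value H \<le> ereal a"
      unfolding critical_value_def by (intro INF_lower) auto
    then show False using assms(5) that by simp
  qed
  have subsol: "\<exists>a<\<eta>. \<exists>u. viscosity_subsolution H a u" if "\<eta> > 0" for \<eta>
  proof -
    have "critical_value H < ereal \<eta>" using assms(5) that by simp
    then show ?thesis unfolding critical_value_def INF_less_iff by auto
  qed
  obtain \<epsilon> \<delta> R0 where out: "\<epsilon> > 0" "\<delta> > 0" "R0 > 0"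
    "\<And>x p. norm x \<ge> R0 \<Longrightarrow> norm p \<le> \<epsilon> \<Longrightarrow> H (x, p) \<le> - \<delta>"
    "\<And>x q. norm x \<ge> R0 \<Longrightarrow> L (x, q) \<ge> \<epsilon> * norm q + \<delta>"
    using strict_at_infinityD[OF assms(3) min_hamiltonian_nonpos[OF subsol]] by blast
  have "\<exists>R M. M \<ge> 1 \<and> (\<forall>a \<tau>. - \<delta> \<le> a \<and> a < 0 \<and> 0 < \<tau> \<and> \<tau> * M \<le> 1 \<longrightarrow>
      (\<exists>x l. chain \<tau> R M x l x \<and> chain_sum (\<lambda>z. L z + a) l < 0))"
    by (rule negative_closed_chain[OF no_subsol out])
  then obtain R M where M: "M \<ge> 1" and loop: "\<forall>a \<tau>. - \<delta> \<le> a \<and> a < 0 \<and> 0 < \<tau> \<and> \<tau> * M \<le> 1 \<longrightarrow>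
      (\<exists>x l. chain \<tau> R M x l x \<and> chain_sum (\<lambda>z. L z + a) l < 0)"
    by (elim exE conjE)
  \<comment> \<open>Levels below the critical one that tend to it, and step durations that tend to 0.\<close>
  define a where "a n = - min \<delta> (1 / real (Suc n))" for n
  define \<tau> where "\<tau> n = 1 / (real (Suc n) * M)" for n
  have a: "- \<delta> \<le> a n" "a n < 0" "- a n \<le> 1 / real (Suc n)" for n
    using out(2) by (auto simp: a_def)
  have \<tau>: "0 < \<tau> n" "\<tau> n * M \<le> 1" for n
    using M by (auto simp: \<tau>_def)
  have "\<forall>n. \<exists>x l. chain (\<tau> n) R M x l x \<and> chain_sum (\<lambda>z. L z + a n) l < 0"
  proof
    show "\<exists>x l. chain (\<tau> n) R M x l x \<and> chain_sum (\<lambda>z. L z + a n) l < 0" for n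
      by (rule loop[rule_format]) (intro conjI a \<tau>)
  qed
  then have "\<exists>x. \<forall>n. \<exists>l. chain (\<tau> n) R M (x n) l (x n) \<and> chain_sum (\<lambda>z. L z + a n) l < 0"
    by (rule choice)
  then obtain x where "\<forall>n. \<exists>l. chain (\<tau> n) R M (x n) l (x n) \<and> chain_sum (\<lambda>z. L z + a n) l < 0" ..
  then have "\<exists>l. \<forall>n. chain (\<tau> n) R M (x n) (l n) (x n) \<and> chain_sum (\<lambda>z. L z + a n) (l n) < 0"
    by (rule choice)
  then obtain l where l: "\<And>n. chain (\<tau> n) R M (x n) (l n) (x n)"
      and neg: "\<And>n. chain_sum (\<lambda>z. L z + a n) (l n) < 0"
    by blast
  define T where "T n = chain_sum (\<lambda>_. 1) (l n)" for n
  have mem: "norm (fst (l n ! i)) \<le> R" "norm (fst (snd (l n ! i))) \<le> M" "0 < snd (snd (l n ! i))"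
    if "i < length (l n)" for n i
    using chain_steps[OF l[of n], of "fst (l n ! i)" "fst (snd (l n ! i))" "snd (snd (l n ! i))"] nth_mem[OF that]
    by (simp_all del: nth_mem)
  have T: "T n > 0" for n
  proof -
    have "l n \<noteq> []" using neg[of n] by auto
    then show ?thesis unfolding T_def chain_sum_conv_sum using mem(3) by (intro sum_pos) auto
  qed
  define N where "N n = length (l n)" for n
  define w where "w n i = snd (snd (l n ! i)) / T n" for n i
  define Z where "Z n i = (fst (l n ! i), fst (snd (l n ! i)))" for n i
  define A where "A F n = (\<Sum>i<N n. w n i * F (Z n i))" for F :: "(real^'n) \<times> (real^'n) \<Rightarrow> real" and n
  have A: "A F n = chain_sum F (l n) / T n" for F n
    unfolding A_def chain_sum_conv_sum N_def w_def Z_def sum_divide_distrib by (intro sum.cong) auto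
  have A_shift: "chain_sum (\<lambda>z. F z + c) (l n) = (A F n + c) * T n" for F c n
    using T[of n] unfolding A chain_sum_add_const T_def[symmetric] by (simp add: field_simps)
  have w1: "(\<Sum>i<N n. w n i) = 1" for n
    using A[of "\<lambda>_. 1" n] T[of n] by (simp add: A_def T_def[symmetric])
  obtain r \<mu> where r: "strict_mono r" and \<mu>: "sets \<mu> = sets borel" "prob_space \<mu>"
    and conv: "\<And>F :: (real^'n) \<times> (real^'n) \<Rightarrow> real. continuous_on UNIV F \<Longrightarrow> integrable \<mu> F \<and> (\<lambda>n. A F (r n)) \<longlonglongrightarrow> (\<integral>z. F z \<partial>\<mu>)"
    unfolding A_def
  proof (rule discrete_measures_subconverge[of N w Z "cball 0 R \<times> cball 0 M"])
    show "bounded (cball 0 R \<times> cball 0 M :: ((real^'n) \<times> (real^'n)) set)" by (intro bounded_Times) auto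
    show "0 \<le> w n i" "Z n i \<in> cball 0 R \<times> cball 0 M" if "i < N n" for n i
      using that mem[of i n] T[of n] by (auto simp: w_def Z_def N_def)
  qed (use w1 in auto)
  interpret \<mu>: prob_space \<mu> by (rule \<mu>(2))
  have inv0: "(\<lambda>n. 1 / real (Suc (r n))) \<longlonglongrightarrow> 0"
    using LIMSEQ_subseq_LIMSEQ[OF LIMSEQ_inverse_real_of_nat r] by (simp add: comp_def inverse_eq_divide)
  have \<tau>0: "(\<lambda>n. \<tau> (r n)) \<longlonglongrightarrow> 0"
    using tendsto_mult_right[OF inv0, of "1 / M"] by (simp add: \<tau>_def)
  have dom_nonneg: "0 \<le> (\<integral>z. \<Phi> z \<partial>\<mu>)" if cont: "continuous_on UNIV \<Phi>" and dom: "dominated_by u \<Phi>" for \<Phi> u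
  proof (rule field_le_epsilon)
    fix e :: real assume e: "e > 0"
    obtain \<tau>0 where \<tau>0': "\<tau>0 > 0" "\<And>\<tau> x l. \<tau> \<le> \<tau>0 \<Longrightarrow> chain \<tau> R M x l x \<Longrightarrow> 0 \<le> chain_sum (\<lambda>z. \<Phi> z + e) l"
      using closed_chain_sum_nonneg[OF dom cont e, of M R] M by auto
    have "\<forall>\<^sub>F n in sequentially. \<tau> (r n) < \<tau>0" by (rule order_tendstoD(2)[OF \<tau>0 \<tau>0'(1)])
    then have "\<forall>\<^sub>F n in sequentially. - e \<le> A \<Phi> (r n)"
    proof eventually_elim
      case (elim n)
      then have "0 \<le> (A \<Phi> (r n) + e) * T (r n)"
        using \<tau>0'(2)[OF _ l[of "r n"]] by (simp add: A_shift)
      then show ?case using T[of "r n"] by (simp add: zero_le_mult_iff)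
    qed
    then have "- e \<le> (\<integral>z. \<Phi> z \<partial>\<mu>)"
      using conv[OF cont] by (intro tendsto_lowerbound[of _ _ sequentially]) auto
    then show "0 \<le> (\<integral>z. \<Phi> z \<partial>\<mu>) + e" by simp
  qed
  \<comment> \<open>The chains have negative action at levels tending to 0; the reverse bound uses subsolutions at levels near 0.\<close>
  have "(\<integral>z. L z \<partial>\<mu>) \<le> 0"
  proof (rule tendsto_le[OF sequentially_bot inv0])
    show "(\<lambda>n. A L (r n)) \<longlonglongrightarrow> (\<integral>z. L z \<partial>\<mu>)" using conv[OF continuous_lagrangian] by simp
    have "A L n \<le> 1 / real (Suc n)" for n
    proof -
      have "(A L n + a n) * T n < 0" using neg[of n] by (simp only: A_shift)
      then have "A L n + a n < 0" using T[of n] by (simp add: mult_less_0_iff)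
      then show ?thesis using a(3)[of n] by linarith
    qed
    then show "\<forall>\<^sub>F n in sequentially. A L (r n) \<le> 1 / real (Suc (r n))" by simp
  qed
  moreover have "0 \<le> (\<integral>z. L z \<partial>\<mu>)"
  proof (rule field_le_epsilon)
    fix e :: real assume e: "e > 0"
    obtain b u where b: "b < e" "viscosity_subsolution H b u" using subsol[OF e] by blast
    have "0 \<le> (\<integral>z. L z + b \<partial>\<mu>)"
      by (rule dom_nonneg[OF _ viscosity_subsolution_dominated[OF b(2)]]) (intro continuous_intros continuous_lagrangian)
    also have "\<dots> = (\<integral>z. L z \<partial>\<mu>) + b"
      using conv[OF continuous_lagrangian] by (simp add: \<mu>.prob_space)
    finally show "0 \<le> (\<integral>z. L z \<partial>\<mu>) + e" using b(1) by simp
  qed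
  ultimately have L0: "pairing \<mu> L = 0"
    using pairing_eq_integral[of \<mu> L] conv[OF continuous_lagrangian] by simp
  show ?thesis
  proof (intro exI[of _ \<mu>] conjI allI impI)
    show "radon_probability \<mu>"
      unfolding radon_probability_def
      using \<mu> inner_regular[OF \<mu>(1)] by (simp add: \<mu>.emeasure_space_1)
    show "pairing \<mu> L = 0" by (rule L0)
    fix \<Phi> :: "(real^'n) \<times> (real^'n) \<Rightarrow> real"
    assume "continuous_on UNIV \<Phi> \<and> bdd_below (range \<Phi>) \<and> (\<exists>u. subsolution_for \<Phi> u)"
    then obtain u where "continuous_on UNIV \<Phi>" "dominated_by u \<Phi>"
      using subsolution_for_dominated by blast
    then show "pairing \<mu> L \<le> pairing \<mu> \<Phi>"
      using dom_nonneg conv[of \<Phi>] by (simp add: L0 pairing_eq_integral)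
  qed
qed

end
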